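(* Let $\Omega\subset\mathbb{R}^n$ be a domain such that $\partial\Omega$ satisfies the exterior sphere condition at every point. Let $I\subset\mathbb{R}$ be an open interval and let $H:I\to\mathbb{R}$ be a $C^3$ function satisfying on $I$ $$H'''H'\big(1+(H')^2\big)+(H'')^2\big(1-(H')^2\big)\le0 .$$ Then for any function $g\in C^0(\partial\Omega,\mathbb{R})$ with values in $I$ there exists a unique solution $\mathsf{y}\in C^0(\overline\Omega)\cap C^2(\Omega)$ (with values in $I$) of the Dirichlet problem $$\begin{cases}\Delta\mathsf{y}=-\dfrac{(H''\circ\mathsf{y})(H'\circ\mathsf{y})}{1+(H'\circ\mathsf{y})^2}|\nabla\mathsf{y}|^2&\text{in }\Omega,\\[2mm]\mathsf{y}=g&\text{on }\partial\Omega.\end{cases}$$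
   Context: The exterior sphere condition at $\xi\in\partial\Omega$ means that there is a closed ball $\overline{B}$ of positive radius with $\overline{B}\cap\overline{\Omega}=\{\xi\}$.
   Formalization: The domain Ω is additionally assumed bounded; without this uniqueness fails, e.g. for Ω a half-space, I = ℝ, H constant and g = 0, where both 0 and x_n are solutions. *)

theory Defs
  imports "HOL-Analysis.Analysis"
begin

definition domain :: "(real ^ 'n) set \<Rightarrow> bool" where
  "domain \<Omega> \<longleftrightarrow> open \<Omega> \<and> connected \<Omega> \<and> \<Omega> \<noteq> {}"

definition exterior_sphere_condition_at :: "(real ^ 'n) set \<Rightarrow> real ^ 'n \<Rightarrow> bool" where
  "exterior_sphere_condition_at \<Omega> \<xi> \<longleftrightarrow>
     (\<exists>c r. r > 0 \<and> cball c r \<inter> closure \<Omega> = {\<xi>})"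

text \<open>For functions of one real variable. Intended for open sets \<open>I\<close>; nothing is
  required of \<open>f\<close> outside \<open>I\<close>.\<close>

definition C_k_on_real :: "nat \<Rightarrow> (real \<Rightarrow> real) \<Rightarrow> real set \<Rightarrow> bool" where
  "C_k_on_real k f I \<longleftrightarrow>
     (\<forall>j<k. \<forall>t\<in>I. (deriv ^^ j) f differentiable (at t)) \<and>
     continuous_on I ((deriv ^^ k) f)"

definition has_partial_at :: "'n \<Rightarrow> (real ^ 'n \<Rightarrow> real) \<Rightarrow> real ^ 'n \<Rightarrow> bool" where
  "has_partial_at i u x \<longleftrightarrow> (\<lambda>t. u (x + t *\<^sub>R axis i 1)) differentiable (at 0)"

text \<open>The value is meaningful only where \<^const>\<open>has_partial_at\<close> holds.\<close>

definition partial :: "'n \<Rightarrow> (real ^ 'n \<Rightarrow> real) \<Rightarrow> real ^ 'n \<Rightarrow> real" where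
  "partial i u x = deriv (\<lambda>t. u (x + t *\<^sub>R axis i 1)) 0"

text \<open>All partial derivatives of order at most \<open>k\<close> exist and are continuous on the
  (open) set \<open>S\<close>.\<close>

fun C_k_on :: "nat \<Rightarrow> (real ^ 'n \<Rightarrow> real) \<Rightarrow> (real ^ 'n) set \<Rightarrow> bool" where
  "C_k_on 0 u S \<longleftrightarrow> continuous_on S u"
| "C_k_on (Suc k) u S \<longleftrightarrow>
     continuous_on S u \<and>
     (\<forall>i. (\<forall>x\<in>S. has_partial_at i u x) \<and> C_k_on k (partial i u) S)"

definition gradient :: "(real ^ 'n \<Rightarrow> real) \<Rightarrow> real ^ 'n \<Rightarrow> real ^ 'n" where
  "gradient u x = (\<chi> i. partial i u x)"

definition laplacian :: "(real ^ 'n \<Rightarrow> real) \<Rightarrow> real ^ 'n \<Rightarrow> real" where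
  "laplacian u x = (\<Sum>i\<in>UNIV. partial i (partial i u) x)"

text \<open>Functions are total here, so a solution is determined only on \<open>closure \<Omega>\<close>.\<close>

definition dirichlet_solution ::
  "(real ^ 'n) set \<Rightarrow> real set \<Rightarrow> (real \<Rightarrow> real) \<Rightarrow> (real ^ 'n \<Rightarrow> real) \<Rightarrow> (real ^ 'n \<Rightarrow> real) \<Rightarrow> bool"
where
  "dirichlet_solution \<Omega> I H g y \<longleftrightarrow>
     continuous_on (closure \<Omega>) y \<and>
     C_k_on 2 y \<Omega> \<and>
     y ` closure \<Omega> \<subseteq> I \<and>
     (\<forall>x\<in>\<Omega>. laplacian y x =
        - (((deriv ^^ 2) H (y x) * deriv H (y x)) / (1 + (deriv H (y x))\<^sup>2))
          * (norm (gradient y x))\<^sup>2) \<and>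
     (\<forall>x\<in>frontier \<Omega>. y x = g x)"

end

theory Submission
  imports Defs "HOL-Library.Function_Algebras"
begin

text \<open>
  Let \<open>F\<close> be an antiderivative of \<open>sqrt (1 + H'^2)\<close>. Since \<open>F'' / F' = H'' H' / (1 + H'^2)\<close>, the
  function \<open>y\<close> solves the equation iff \<open>F \<circ> y\<close> is harmonic, so the claim is the classical Dirichlet
  problem; \<open>F\<close> is strictly increasing, and the maximum principle keeps the solution in \<open>F ` I\<close>.

  The Dirichlet problem is solved without Poisson integrals. On a ball with polynomial data \<open>p\<close>, the
  map \<open>s \<mapsto> \<Delta>((r^2 - |x - c|^2) s)\<close> is injective on polynomials of bounded degree by the maximum
  principle, hence surjective, and yields a harmonic polynomial that agrees with \<open>p\<close> on the sphere.
  Interior gradient bounds, obtained by reflection and comparison in a half cube, pass from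
  polynomial to continuous data. On a general domain, Poincare's method of sweeping
  replaces a subharmonic function by its harmonic extension on a countable family of balls, each
  visited infinitely often; barriers built from the exterior spheres control the boundary values.
\<close>

section \<open>Functions with continuous second partial derivatives\<close>

text \<open>\<open>C_k_on\<close> speaks only of derivatives along the axes. For such functions
  neither the symmetry of mixed partials nor the harmonicity of derivatives of harmonic functions is
  evident; for polynomials both are algebra. This shapes the order: the first-derivative bound is
  applied twice to differences of harmonic polynomials, which controls second derivatives and makes
  uniform limits of harmonic polynomials harmonic. Arbitrary uniform limits follow by comparing the
  limit with the Dirichlet solution on a ball. The maximum principle enters in its weak form on
  bounded open sets, and a uniform Lipschitz bound does the work of Harnack's theorem for the
  monotone limits of sweeping. Sweeping starts from subharmonic data \<open>p\<close>: then
  \<open>p\<close> lies below all iterates, which settles the lower half of the continuity at the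
  boundary, and barriers are spent on the upper half. Polynomial data are differences of two such
  functions, because a large multiple of the squared norm makes any polynomial subharmonic on a
  bounded set, and continuous data are uniform limits of polynomials.\<close>

definition has_partial :: "'n \<Rightarrow> (real ^ 'n \<Rightarrow> real) \<Rightarrow> real ^ 'n \<Rightarrow> real \<Rightarrow> bool" where
  "has_partial i u x D \<longleftrightarrow> ((\<lambda>t. u (x + t *\<^sub>R axis i 1)) has_real_derivative D) (at 0)"

lemma has_partial_imp_partial: "has_partial i u x D \<Longrightarrow> partial i u x = D"
  unfolding has_partial_def partial_def by (rule DERIV_imp_deriv)

lemma has_partial_at_iff: "has_partial_at i u x \<longleftrightarrow> has_partial i u x (partial i u x)"
  unfolding has_partial_at_def has_partial_def partial_def
  by (metis DERIV_imp_deriv real_differentiable_def)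

lemma has_partial_imp_has_partial_at: "has_partial i u x D \<Longrightarrow> has_partial_at i u x"
  using has_partial_at_iff has_partial_imp_partial by blast

lemma has_partial_const: "has_partial i (\<lambda>x. c) x 0"
  by (simp add: has_partial_def)

lemma has_partial_add:
  "has_partial i u x a \<Longrightarrow> has_partial i v x b \<Longrightarrow> has_partial i (\<lambda>x. u x + v x) x (a + b)"
  unfolding has_partial_def by (rule DERIV_add)

lemma has_partial_mult:
  "has_partial i u x a \<Longrightarrow> has_partial i v x b \<Longrightarrow>
    has_partial i (\<lambda>x. u x * v x) x (a * v x + u x * b)"
  unfolding has_partial_def by (drule (1) DERIV_mult) (simp add: mult.commute add.commute)

lemma has_partial_cmult: "has_partial i u x a \<Longrightarrow> has_partial i (\<lambda>x. c * u x) x (c * a)"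
  unfolding has_partial_def by (rule DERIV_cmult)

lemma has_partial_compose:
  "has_partial i u x a \<Longrightarrow> (\<phi> has_real_derivative b) (at (u x)) \<Longrightarrow>
    has_partial i (\<lambda>x. \<phi> (u x)) x (b * a)"
  unfolding has_partial_def
  by (rule DERIV_chain2[where f = \<phi> and g = "\<lambda>t. u (x + t *\<^sub>R axis i 1)"]) simp_all

lemma has_partial_linear:
  assumes "bounded_linear f"
  shows "has_partial i f x (f (axis i 1))"
proof -
  have "(\<lambda>t. f (x + t *\<^sub>R axis i 1)) = (\<lambda>t. f x + t * f (axis i 1))"
    using linear_simps(1)[OF assms] linear_simps(5)[OF assms] by auto
  then show ?thesis unfolding has_partial_def by (auto intro!: derivative_eq_intros)
qed

lemma has_partial_sum:
  "finite A \<Longrightarrow> (\<And>k. k \<in> A \<Longrightarrow> has_partial i (u k) x (d k)) \<Longrightarrow>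
    has_partial i (\<lambda>x. \<Sum>k\<in>A. u k x) x (\<Sum>k\<in>A. d k)"
  by (induction A rule: finite_induct) (auto intro: has_partial_const has_partial_add)

lemma has_partial_transform:
  assumes "has_partial i u x D" "open S" "x \<in> S" "\<And>y. y \<in> S \<Longrightarrow> u y = v y"
  shows "has_partial i v x D"
proof -
  have "open ((\<lambda>t. x + t *\<^sub>R axis i 1) -` S)"
    by (intro open_vimage continuous_intros assms)
  with assms show ?thesis unfolding has_partial_def
    by (elim has_field_derivative_transform_within_open) auto
qed

lemma has_partial_shift:
  assumes "has_partial i u (x + s *\<^sub>R axis i 1) D"
  shows "((\<lambda>t. u (x + t *\<^sub>R axis i 1)) has_real_derivative D) (at s)"
proof -
  have "((\<lambda>t. u (x + (t + s) *\<^sub>R axis i 1)) has_real_derivative D) (at 0)"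
    using assms unfolding has_partial_def by (simp add: algebra_simps)
  then show ?thesis
    using DERIV_shift[of "\<lambda>t. u (x + t *\<^sub>R axis i 1)" D 0 s] by simp
qed

text \<open>The derivatives are named by explicit functions \<open>d\<close> and \<open>dd\<close>,
  of which nothing is asked off \<open>S\<close>. Candidates found by the rules for
  \<open>has_partial\<close> can thus be checked pointwise before they are identified with
  \<open>partial\<close>, which is a value of \<open>deriv\<close> and obeys no rules by
  itself.\<close>

definition C2_with ::
  "(real ^ 'n) set \<Rightarrow> (real ^ 'n \<Rightarrow> real) \<Rightarrow> ('n \<Rightarrow> real ^ 'n \<Rightarrow> real) \<Rightarrow>
    ('n \<Rightarrow> 'n \<Rightarrow> real ^ 'n \<Rightarrow> real) \<Rightarrow> bool" where
  "C2_with S u d dd \<longleftrightarrow> continuous_on S u \<and> (\<forall>i. continuous_on S (d i)) \<and>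
     (\<forall>i j. continuous_on S (dd i j)) \<and> (\<forall>x\<in>S. \<forall>i. has_partial i u x (d i x)) \<and>
     (\<forall>x\<in>S. \<forall>i j. has_partial j (d i) x (dd i j x))"

lemma C2_with_partials:
  "C_k_on 2 u S \<Longrightarrow> C2_with S u (\<lambda>i. partial i u) (\<lambda>i j. partial j (partial i u))"
  by (auto simp: C2_with_def numeral_2_eq_2 has_partial_at_iff)

text \<open>\<open>partial i u\<close> agrees with \<open>d i\<close> on \<open>S\<close> only; its
  derivatives are obtained from those of \<open>d i\<close> because \<open>S\<close> is open and
  short axis segments stay in it.\<close>

lemma C2_withD:
  assumes "open S" "C2_with S u d dd"
  shows "C_k_on 2 u S"
    and "\<And>x. x \<in> S \<Longrightarrow> laplacian u x = (\<Sum>i\<in>UNIV. dd i i x)"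
    and "\<And>x. x \<in> S \<Longrightarrow> gradient u x = (\<chi> i. d i x)"
proof -
  note u = assms(2)[unfolded C2_with_def]
  have d: "partial i u x = d i x" if "x \<in> S" for i x
    using u that by (auto intro: has_partial_imp_partial)
  have hdd: "has_partial j (partial i u) x (dd i j x)" if "x \<in> S" for i j x
    using has_partial_transform[of j "d i" x "dd i j x" S "partial i u"] assms that u d
    by auto
  then have dd: "partial j (partial i u) x = dd i j x" if "x \<in> S" for i j x
    using that by (auto intro: has_partial_imp_partial)
  show "C_k_on 2 u S"
  proof -
    have "has_partial_at i u x" if "x \<in> S" for i x
      using u that has_partial_imp_has_partial_at by blast
    then show ?thesis
      using u d dd has_partial_imp_has_partial_at[OF hdd]
      by (simp add: numeral_2_eq_2 cong: continuous_on_cong)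
  qed
  show "\<And>x. x \<in> S \<Longrightarrow> laplacian u x = (\<Sum>i\<in>UNIV. dd i i x)"
    by (simp add: laplacian_def dd)
  show "\<And>x. x \<in> S \<Longrightarrow> gradient u x = (\<chi> i. d i x)"
    by (simp add: gradient_def d)
qed

lemma C2_continuous: "C_k_on 2 u S \<Longrightarrow> continuous_on S u"
  by (simp add: numeral_2_eq_2)

lemma C2_subset: "C_k_on 2 u S \<Longrightarrow> T \<subseteq> S \<Longrightarrow> C_k_on 2 u T"
  by (auto simp: numeral_2_eq_2 intro: continuous_on_subset)

lemma
  assumes "open S" "C_k_on 2 u S" "C_k_on 2 v S"
  shows C2_add: "C_k_on 2 (\<lambda>x. u x + v x) S"
    and laplacian_add: "x \<in> S \<Longrightarrow> laplacian (\<lambda>x. u x + v x) x = laplacian u x + laplacian v x"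
proof -
  have *: "C2_with S (\<lambda>x. u x + v x) (\<lambda>i x. partial i u x + partial i v x)
      (\<lambda>i j x. partial j (partial i u) x + partial j (partial i v) x)"
    using assms(2,3)[THEN C2_with_partials]
    by (auto simp: C2_with_def intro: continuous_intros has_partial_add)
  show "C_k_on 2 (\<lambda>x. u x + v x) S" by (rule C2_withD[OF assms(1) *])
  show "x \<in> S \<Longrightarrow> laplacian (\<lambda>x. u x + v x) x = laplacian u x + laplacian v x"
    by (subst C2_withD(2)[OF assms(1) *]) (auto simp: sum.distrib laplacian_def)
qed

lemma
  assumes "open S" "C_k_on 2 u S"
  shows C2_cmult: "C_k_on 2 (\<lambda>x. c * u x) S"
    and laplacian_cmult: "x \<in> S \<Longrightarrow> laplacian (\<lambda>x. c * u x) x = c * laplacian u x"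
proof -
  have *: "C2_with S (\<lambda>x. c * u x) (\<lambda>i x. c * partial i u x)
      (\<lambda>i j x. c * partial j (partial i u) x)"
    using assms(2)[THEN C2_with_partials]
    by (auto simp: C2_with_def intro: continuous_intros has_partial_cmult)
  show "C_k_on 2 (\<lambda>x. c * u x) S" by (rule C2_withD[OF assms(1) *])
  show "x \<in> S \<Longrightarrow> laplacian (\<lambda>x. c * u x) x = c * laplacian u x"
    by (subst C2_withD(2)[OF assms(1) *]) (auto simp: sum_distrib_left laplacian_def)
qed

lemma
  assumes "open S" "C_k_on 2 u S" "C_k_on 2 v S"
  shows C2_diff: "C_k_on 2 (\<lambda>x. u x - v x) S"
    and laplacian_diff: "x \<in> S \<Longrightarrow> laplacian (\<lambda>x. u x - v x) x = laplacian u x - laplacian v x"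
  using C2_add[OF assms(1,2) C2_cmult[OF assms(1,3), of "-1"]]
    laplacian_add[OF assms(1,2) C2_cmult[OF assms(1,3), of "-1"], of x]
    laplacian_cmult[OF assms(1,3), of x "-1"] by auto

lemma
  assumes "open S" "C_k_on 2 u S" "\<And>x. x \<in> S \<Longrightarrow> u x = v x"
  shows C2_cong: "C_k_on 2 v S"
    and laplacian_cong: "x \<in> S \<Longrightarrow> laplacian v x = laplacian u x"
proof -
  have *: "C2_with S v (\<lambda>i. partial i u) (\<lambda>i j. partial j (partial i u))"
    using assms(2)[THEN C2_with_partials] assms(3)
      has_partial_transform[of _ u _ _ S v, OF _ assms(1) _ assms(3)]
    by (simp add: C2_with_def cong: continuous_on_cong)
  show "C_k_on 2 v S" by (rule C2_withD[OF assms(1) *])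
  show "x \<in> S \<Longrightarrow> laplacian v x = laplacian u x"
    by (subst C2_withD(2)[OF assms(1) *]) (auto simp: laplacian_def)
qed

lemma C2_local:
  fixes u :: "real ^ 'n \<Rightarrow> real"
  assumes "\<And>x. x \<in> S \<Longrightarrow> \<exists>T. open T \<and> x \<in> T \<and> C_k_on 2 u T"
  shows "C_k_on 2 u S"
proof -
  have "continuous_on S f" if "\<And>T. C_k_on 2 u T \<Longrightarrow> continuous_on T f" for f :: "real^'n \<Rightarrow> real"
    using assms that by (meson continuous_at_imp_continuous_on continuous_on_eq_continuous_at)
  then show ?thesis using assms unfolding numeral_2_eq_2 C_k_on.simps by blast
qed

text \<open>The chain rule behind every change of variable here: it is applied to the exponential of
  the squared distance in the barrier, to \<open>F\<close> in the reduction of the equation, and to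
  the inverse of \<open>F\<close> on the way back. The last two live on an interval, hence the set
  \<open>J\<close>.\<close>

lemma
  fixes v :: "real ^ 'n \<Rightarrow> real"
  assumes "open S" "C_k_on 2 v S" "v ` S \<subseteq> J"
    and \<phi>: "\<And>s. s \<in> J \<Longrightarrow> (\<phi> has_real_derivative \<phi>1 s) (at s)"
    and \<phi>1: "\<And>s. s \<in> J \<Longrightarrow> (\<phi>1 has_real_derivative \<phi>2 s) (at s)"
    and \<phi>2: "continuous_on J \<phi>2"
  shows C2_compose: "C_k_on 2 (\<lambda>x. \<phi> (v x)) S"
    and laplacian_compose: "x \<in> S \<Longrightarrow> laplacian (\<lambda>x. \<phi> (v x)) x =
      \<phi>1 (v x) * laplacian v x + \<phi>2 (v x) * (norm (gradient v x))\<^sup>2"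
proof -
  note v = C2_with_partials[OF assms(2), unfolded C2_with_def]
  have cv: "continuous_on S v" using v by blast
  have "continuous_on J \<phi>" "continuous_on J \<phi>1"
    using \<phi> \<phi>1 by (auto intro: continuous_at_imp_continuous_on DERIV_isCont)
  then have c: "continuous_on S (\<lambda>x. \<phi> (v x))" "continuous_on S (\<lambda>x. \<phi>1 (v x))"
      "continuous_on S (\<lambda>x. \<phi>2 (v x))"
    using continuous_on_compose2[OF _ cv assms(3)] \<phi>2 by auto
  have *: "C2_with S (\<lambda>x. \<phi> (v x)) (\<lambda>i x. \<phi>1 (v x) * partial i v x)
      (\<lambda>i j x. \<phi>2 (v x) * partial j v x * partial i v x + \<phi>1 (v x) * partial j (partial i v) x)"
    unfolding C2_with_def
  proof (intro conjI ballI allI)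
    fix x i j assume x: "x \<in> S"
    then have "v x \<in> J" using assms(3) by auto
    then show "has_partial i (\<lambda>x. \<phi> (v x)) x (\<phi>1 (v x) * partial i v x)"
      using v x by (auto intro: has_partial_compose \<phi>)
    have "has_partial j (\<lambda>x. \<phi>1 (v x)) x (\<phi>2 (v x) * partial j v x)"
      using v x \<open>v x \<in> J\<close> by (intro has_partial_compose \<phi>1) auto
    then show "has_partial j (\<lambda>x. \<phi>1 (v x) * partial i v x) x
        (\<phi>2 (v x) * partial j v x * partial i v x + \<phi>1 (v x) * partial j (partial i v) x)"
      using v x by (intro has_partial_mult) auto
  qed (use v in \<open>auto intro!: continuous_intros c\<close>)
  show "C_k_on 2 (\<lambda>x. \<phi> (v x)) S" by (rule C2_withD[OF assms(1) *])
  show "x \<in> S \<Longrightarrow> laplacian (\<lambda>x. \<phi> (v x)) x =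
      \<phi>1 (v x) * laplacian v x + \<phi>2 (v x) * (norm (gradient v x))\<^sup>2"
    by (subst C2_withD(2)[OF assms(1) *])
      (auto simp: laplacian_def sum.distrib sum_distrib_left gradient_def norm_vec_def L2_set_def
        sum_nonneg power2_eq_square mult.assoc)
qed

lemma C2_const: "C_k_on 2 (\<lambda>x. c) S" and laplacian_const: "laplacian (\<lambda>x. c) x = 0"
proof -
  have *: "C2_with UNIV (\<lambda>x. c) (\<lambda>i x. 0) (\<lambda>i j x. 0)"
    by (simp add: C2_with_def has_partial_const)
  show "C_k_on 2 (\<lambda>x. c) S" using C2_withD(1)[OF open_UNIV *] C2_subset by blast
  show "laplacian (\<lambda>x. c) x = 0" using C2_withD(2)[OF open_UNIV *] by simp
qed

lemma has_partial_coord: "has_partial i (\<lambda>x. x $ k - a) x (if i = k then 1 else 0)"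
  unfolding has_partial_def
  by (auto simp: axis_def intro!: derivative_eq_intros)

lemma norm_sq_vec: "(norm (x :: real ^ 'n))\<^sup>2 = (\<Sum>i\<in>UNIV. (x $ i)\<^sup>2)"
  by (simp add: norm_vec_def L2_set_def sum_nonneg)

lemma C2_coord: "C_k_on 2 (\<lambda>x :: real ^ 'n. x $ k - a) S"
  and laplacian_coord: "laplacian (\<lambda>x :: real ^ 'n. x $ k - a) x = 0"
  and C2_coord_sq: "C_k_on 2 (\<lambda>x :: real ^ 'n. (x $ k - a)\<^sup>2) S"
  and laplacian_coord_sq: "laplacian (\<lambda>x :: real ^ 'n. (x $ k - a)\<^sup>2) x = 2"
proof -
  let ?\<delta> = "\<lambda>i. if i = k then 1 else 0 :: real"
  have 1: "C2_with UNIV (\<lambda>x :: real ^ 'n. x $ k - a) (\<lambda>i x. ?\<delta> i) (\<lambda>i j x. 0)"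
    by (auto simp: C2_with_def has_partial_const has_partial_coord intro!: continuous_intros)
  have 2: "C2_with UNIV (\<lambda>x :: real ^ 'n. (x $ k - a)\<^sup>2) (\<lambda>i x. (2 * ?\<delta> i) * (x $ k - a))
      (\<lambda>i j x. (2 * ?\<delta> i) * ?\<delta> j)"
  proof -
    have "has_partial i (\<lambda>x. (x $ k - a)\<^sup>2) x (2 * ?\<delta> i * (x $ k - a))" for i and x :: "real ^ 'n"
    proof -
      have "has_partial i (\<lambda>x. (x $ k - a) * (x $ k - a)) x (?\<delta> i * (x $ k - a) + (x $ k - a) * ?\<delta> i)"
        by (intro has_partial_mult has_partial_coord)
      then show ?thesis by (cases "i = k") (simp_all add: power2_eq_square)
    qed
    moreover have "has_partial j (\<lambda>x. (2 * ?\<delta> i) * (x $ k - a)) x ((2 * ?\<delta> i) * ?\<delta> j)"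
      for i j and x :: "real ^ 'n"
      by (intro has_partial_cmult has_partial_coord)
    ultimately show ?thesis unfolding C2_with_def by (auto intro!: continuous_intros)
  qed
  show "C_k_on 2 (\<lambda>x :: real ^ 'n. x $ k - a) S"
    using C2_withD(1)[OF open_UNIV 1] C2_subset by blast
  show "laplacian (\<lambda>x :: real ^ 'n. x $ k - a) x = 0"
    using C2_withD(2)[OF open_UNIV 1] by simp
  show "C_k_on 2 (\<lambda>x :: real ^ 'n. (x $ k - a)\<^sup>2) S"
    using C2_withD(1)[OF open_UNIV 2] C2_subset by blast
  show "laplacian (\<lambda>x :: real ^ 'n. (x $ k - a)\<^sup>2) x = 2"
    using C2_withD(2)[OF open_UNIV 2] by (simp add: if_distrib cong: if_cong)
qed

lemma C2_norm_sq: "C_k_on 2 (\<lambda>x :: real ^ 'n. (norm (x - c))\<^sup>2) S"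
  and laplacian_norm_sq: "laplacian (\<lambda>x :: real ^ 'n. (norm (x - c))\<^sup>2) x = 2 * CARD('n)"
  and gradient_norm_sq: "gradient (\<lambda>x :: real ^ 'n. (norm (x - c))\<^sup>2) x = 2 *\<^sub>R (x - c)"
proof -
  have p: "has_partial i (\<lambda>x. (norm (x - c))\<^sup>2) x (2 * (x $ i - c $ i))" for i and x :: "real ^ 'n"
  proof -
    have "has_partial i (\<lambda>x. \<Sum>k\<in>UNIV. (x $ k - c $ k) * (x $ k - c $ k)) x
      (\<Sum>k\<in>UNIV. (if i = k then 1 else 0) * (x $ k - c $ k) + (x $ k - c $ k) * (if i = k then 1 else 0))"
      by (intro has_partial_sum has_partial_mult has_partial_coord) auto
    then show ?thesis
      by (simp add: norm_sq_vec power2_eq_square[of "_ $ _ - _ $ _"] sum.distrib if_distrib cong: if_cong)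
  qed
  have *: "C2_with UNIV (\<lambda>x :: real ^ 'n. (norm (x - c))\<^sup>2) (\<lambda>i x. 2 * (x $ i - c $ i))
      (\<lambda>i j x. 2 * (if j = i then 1 else 0))"
    unfolding C2_with_def
    by (intro conjI allI ballI p has_partial_cmult has_partial_coord continuous_intros)
  show "C_k_on 2 (\<lambda>x :: real ^ 'n. (norm (x - c))\<^sup>2) S"
    using C2_withD(1)[OF open_UNIV *] C2_subset by blast
  show "laplacian (\<lambda>x :: real ^ 'n. (norm (x - c))\<^sup>2) x = 2 * CARD('n)"
    using C2_withD(2)[OF open_UNIV *] by simp
  show "gradient (\<lambda>x :: real ^ 'n. (norm (x - c))\<^sup>2) x = 2 *\<^sub>R (x - c)"
    using C2_withD(3)[OF open_UNIV *, of x] by (simp add: vec_eq_iff)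
qed

section \<open>The weak maximum principle and harmonic functions\<close>

lemma local_max_second_derivative:
  fixes f :: "real \<Rightarrow> real"
  assumes "\<delta> > 0" and f: "\<And>t. \<bar>t\<bar> < \<delta> \<Longrightarrow> (f has_real_derivative f' t) (at t)"
    and f': "(f' has_real_derivative c) (at 0)"
    and max: "\<And>t. \<bar>t\<bar> < \<delta> \<Longrightarrow> f t \<le> f 0"
  shows "c \<le> 0"
proof (rule ccontr)
  assume "\<not> c \<le> 0"
  \<comment> \<open>If \<open>c > 0\<close>, the derivative vanishes at 0 and is positive just to
    the right of it, so \<open>f\<close> rises above its maximum.\<close>
  have "f' 0 = 0"
    using DERIV_local_max[OF f[of 0], of \<delta>] assms(1) max by auto
  with DERIV_pos_inc_right[OF f'] \<open>\<not> c \<le> 0\<close> obtain d where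
    d: "d > 0" "\<And>h. 0 < h \<Longrightarrow> h < d \<Longrightarrow> 0 < f' h" by auto
  define s where "s = min d \<delta> / 2"
  have s: "0 < s" "s < d" "s < \<delta>" using d(1) assms(1) by (auto simp: s_def min_def)
  have "f 0 < f s"
  proof (rule DERIV_pos_imp_increasing_open[OF s(1)])
    show "\<exists>y. DERIV f x :> y \<and> 0 < y" if "0 < x" "x < s" for x
      using that s f[of x] d(2)[of x] by auto
    show "continuous_on {0..s} f"
      using s by (auto intro!: continuous_at_imp_continuous_on DERIV_isCont[OF f])
  qed
  with max[of s] s show False by simp
qed

lemma laplacian_local_max:
  fixes w :: "real ^ 'n \<Rightarrow> real"
  assumes "open V" "C_k_on 2 w V" "z \<in> V" and max: "\<And>x. x \<in> V \<Longrightarrow> w x \<le> w z"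
  shows "laplacian w z \<le> 0"
  unfolding laplacian_def
proof (rule sum_nonpos)
  fix i :: 'n
  note w = C2_with_partials[OF assms(2), unfolded C2_with_def]
  obtain \<delta> where \<delta>: "\<delta> > 0" "ball z \<delta> \<subseteq> V"
    using assms(1,3) openE by blast
  have V: "z + t *\<^sub>R axis i 1 \<in> V" if "\<bar>t\<bar> < \<delta>" for t
    using \<delta>(2) that by (auto simp: dist_norm subset_iff)
  show "partial i (partial i w) z \<le> 0"
  proof (rule local_max_second_derivative[OF \<delta>(1)])
    show "((\<lambda>t. w (z + t *\<^sub>R axis i 1)) has_real_derivative partial i w (z + t *\<^sub>R axis i 1)) (at t)"
      if "\<bar>t\<bar> < \<delta>" for t
      using w V[OF that] by (intro has_partial_shift) auto
    show "((\<lambda>t. partial i w (z + t *\<^sub>R axis i 1)) has_real_derivative partial i (partial i w) z) (at 0)"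
      using w assms(3) by (auto simp: has_partial_def)
    show "w (z + t *\<^sub>R axis i 1) \<le> w (z + 0 *\<^sub>R axis i 1)" if "\<bar>t\<bar> < \<delta>" for t
      using max[OF V[OF that]] by simp
  qed
qed

text \<open>Adding \<open>\<epsilon>\<close> times the squared norm makes the Laplacian strictly
  positive, which \<open>laplacian_local_max\<close> forbids at an interior maximum.\<close>

theorem maximum_principle:
  fixes u :: "real ^ 'n \<Rightarrow> real"
  assumes "open V" "bounded V" "continuous_on (closure V) u" "C_k_on 2 u V"
    and sub: "\<And>x. x \<in> V \<Longrightarrow> 0 \<le> laplacian u x"
    and bd: "\<And>x. x \<in> frontier V \<Longrightarrow> u x \<le> M"
    and "x \<in> closure V"
  shows "u x \<le> M"
proof (rule ccontr)
  assume "\<not> u x \<le> M"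
  obtain B where B: "\<And>y. y \<in> closure V \<Longrightarrow> norm y \<le> B"
    using bounded_closure[OF assms(2)] by (auto simp: bounded_iff)
  \<comment> \<open>Small enough that on the frontier the perturbed function is at most
    \<open>M + \<epsilon> * B\<^sup>2 < u x\<close>, so its maximum lies inside; the summand 1
    avoids division by zero when \<open>B = 0\<close>.\<close>
  define \<epsilon> where "\<epsilon> = (u x - M) / (2 * (1 + B\<^sup>2))"
  have B2: "1 + B\<^sup>2 > 0" by (simp add: add_pos_nonneg)
  have \<epsilon>: "\<epsilon> > 0" "\<epsilon> * B\<^sup>2 < u x - M"
  proof -
    show "\<epsilon> > 0" using \<open>\<not> u x \<le> M\<close> B2 by (simp add: \<epsilon>_def)
    have "\<epsilon> * (2 * (1 + B\<^sup>2)) = u x - M" using B2 by (simp add: \<epsilon>_def)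
    moreover have "\<epsilon> * B\<^sup>2 \<ge> 0" using \<open>\<epsilon> > 0\<close> by simp
    ultimately show "\<epsilon> * B\<^sup>2 < u x - M" using \<open>\<epsilon> > 0\<close> unfolding distrib_left by linarith
  qed
  define w where "w = (\<lambda>y. u y + \<epsilon> * (norm (y - 0))\<^sup>2)"
  have "compact (closure V)" using assms(2) by (simp add: compact_closure)
  moreover have "continuous_on (closure V) w"
    unfolding w_def by (intro continuous_intros assms(3))
  ultimately obtain z where z: "z \<in> closure V" "\<And>y. y \<in> closure V \<Longrightarrow> w y \<le> w z"
    using continuous_attains_sup[of "closure V" w] assms(7) by (metis empty_iff)
  have "z \<notin> frontier V"
  proof
    assume "z \<in> frontier V"
    then have "w z \<le> M + \<epsilon> * B\<^sup>2"
      using bd[of z] B[OF z(1)] \<epsilon>(1) by (auto simp: w_def intro!: add_mono mult_left_mono power_mono)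
    moreover have "u x \<le> w x" using \<epsilon> by (simp add: w_def)
    ultimately show False using z(2)[OF assms(7)] \<epsilon>(2) by linarith
  qed
  then have "z \<in> V" using z(1) assms(1) by (simp add: frontier_def interior_open)
  note q = C2_norm_sq[of 0 V]
  have "laplacian w z \<le> 0"
    using z(2) closure_subset[of V] \<open>z \<in> V\<close> assms(1)
      C2_add[OF assms(1,4) C2_cmult[OF assms(1) q]]
    by (intro laplacian_local_max[of V]) (auto simp: w_def)
  moreover have "laplacian w z = laplacian u z + \<epsilon> * (2 * CARD('n))"
    unfolding w_def
    using laplacian_add[OF assms(1,4) C2_cmult[OF assms(1) q] \<open>z \<in> V\<close>]
      laplacian_cmult[OF assms(1) q \<open>z \<in> V\<close>] laplacian_norm_sq[where c = "0 :: real ^ 'n"] by simp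
  moreover have "\<epsilon> * (2 * CARD('n)) > 0" using \<epsilon>(1) by simp
  ultimately show False using sub[OF \<open>z \<in> V\<close>] by linarith
qed

definition harmonic_on :: "(real ^ 'n) set \<Rightarrow> (real ^ 'n \<Rightarrow> real) \<Rightarrow> bool" where
  "harmonic_on S u \<longleftrightarrow> C_k_on 2 u S \<and> (\<forall>x\<in>S. laplacian u x = 0)"

lemma harmonic_on_subset: "harmonic_on S u \<Longrightarrow> T \<subseteq> S \<Longrightarrow> harmonic_on T u"
  unfolding harmonic_on_def using C2_subset by blast

lemma harmonic_on_cong:
  "open S \<Longrightarrow> harmonic_on S u \<Longrightarrow> (\<And>x. x \<in> S \<Longrightarrow> u x = v x) \<Longrightarrow> harmonic_on S v"
  unfolding harmonic_on_def using C2_cong[of S u v] laplacian_cong[of S u v] by auto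

lemma harmonic_on_diff:
  "open S \<Longrightarrow> harmonic_on S u \<Longrightarrow> harmonic_on S v \<Longrightarrow> harmonic_on S (\<lambda>x. u x - v x)"
  by (simp add: harmonic_on_def C2_diff laplacian_diff)

lemma harmonic_on_cmult:
  "open S \<Longrightarrow> harmonic_on S u \<Longrightarrow> harmonic_on S (\<lambda>x. c * u x)"
  by (simp add: harmonic_on_def C2_cmult laplacian_cmult)

lemma harmonic_on_local:
  assumes "\<And>x. x \<in> S \<Longrightarrow> \<exists>T. open T \<and> x \<in> T \<and> harmonic_on T u"
  shows "harmonic_on S u"
  using assms C2_local[of S u] unfolding harmonic_on_def by blast

text \<open>Two-sided form, from \<open>u\<close> and \<open>- u\<close>. For a difference,
  \<open>M = 0\<close> gives uniqueness, and small \<open>M\<close> carries uniform convergence from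
  the frontier to the closure.\<close>

lemma harmonic_bound:
  fixes u :: "real ^ 'n \<Rightarrow> real"
  assumes "open V" "bounded V" "continuous_on (closure V) u" "harmonic_on V u"
    and bd: "\<And>x. x \<in> frontier V \<Longrightarrow> \<bar>u x\<bar> \<le> M"
    and "x \<in> closure V"
  shows "\<bar>u x\<bar> \<le> M"
proof -
  have *: "v x \<le> M" if "continuous_on (closure V) v" "harmonic_on V v"
    "\<And>x. x \<in> frontier V \<Longrightarrow> v x \<le> M" for v
    using that assms(6)
    by (auto simp: harmonic_on_def intro: maximum_principle[OF assms(1,2) that(1) _ _ that(3)])
  have "u x \<le> M"
    using bd by (intro *[OF assms(3,4)]) (auto simp: abs_le_iff)
  moreover have "(-1) * u x \<le> M"
    using bd by (intro *[OF _ harmonic_on_cmult[OF assms(1,4)]] continuous_intros assms(3))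
      (auto simp: abs_le_iff)
  ultimately show ?thesis by simp
qed

section \<open>Harmonic polynomials\<close>

text \<open>The images of a basis \<open>B\<close> are independent, and \<open>span S\<close> has no
  room for \<open>card B + 1\<close> independent vectors. Linearity is asked on the span only, since
  the Laplacian is additive on twice differentiable functions but not on all total
  functions.\<close>

lemma (in vector_space) injective_imp_surjective_on_span:
  assumes "finite S"
    and into: "\<And>x. x \<in> span S \<Longrightarrow> L x \<in> span S"
    and lin: "\<And>a x y. x \<in> span S \<Longrightarrow> y \<in> span S \<Longrightarrow> L (scale a x + y) = scale a (L x) + L y"
    and ker: "\<And>x. x \<in> span S \<Longrightarrow> L x = 0 \<Longrightarrow> x = 0"
    and y: "y \<in> span S"
  shows "\<exists>x\<in>span S. L x = y"
proof -
  obtain B where B: "B \<subseteq> S" "independent B" "S \<subseteq> span B"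
    using maximal_independent_subset by blast
  have fin: "finite B" using B(1) assms(1) finite_subset by blast
  have sp: "span B = span S"
    using B by (metis span_mono span_span subset_antisym)
  \<comment> \<open>With the factor -1 the rule reads \<open>L 0 = - L 0 + L 0\<close>.\<close>
  have L0: "L 0 = 0"
    using lin[of 0 0 "-1"] span_zero by simp
  have BS: "b \<in> span S" if "b \<in> B" for b using that B(1) span_base by blast
  have Lsum: "(\<Sum>b\<in>A. scale (u b) b) \<in> span S \<and>
      L (\<Sum>b\<in>A. scale (u b) b) = (\<Sum>b\<in>A. scale (u b) (L b))" if "A \<subseteq> B" for u A
  proof -
    have "finite A" using that fin finite_subset by blast
    then show ?thesis using that
      by (induction A rule: finite_induct) (auto simp: L0 span_zero lin BS intro!: span_add span_scale)
  qed
  have inj: "inj_on L B"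
  proof (rule inj_onI)
    fix a b assume ab: "a \<in> B" "b \<in> B" "L a = L b"
    then have "L (scale (-1) a + b) = 0" using lin[OF BS[OF ab(1)] BS[OF ab(2)], of "-1"] by simp
    moreover have "scale (-1) a + b \<in> span S" using ab BS by (intro span_add span_scale) auto
    ultimately have "scale (-1) a + b = 0" by (rule ker[rotated])
    then show "a = b" by simp
  qed
  have ind: "independent (L ` B)"
  proof
    assume "dependent (L ` B)"
    then obtain u b0 where u: "b0 \<in> B" "u (L b0) \<noteq> 0" "(\<Sum>v\<in>L ` B. scale (u v) v) = 0"
      using fin by (auto simp: dependent_finite)
    then have "L (\<Sum>b\<in>B. scale (u (L b)) b) = 0"
      using Lsum[of B "\<lambda>b. u (L b)"] by (simp add: sum.reindex[OF inj])
    then have "(\<Sum>b\<in>B. scale (u (L b)) b) = 0"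
      using Lsum[of B "\<lambda>b. u (L b)"] ker by blast
    then have "dependent B" using fin u by (auto simp: dependent_finite intro!: exI[of _ "\<lambda>b. u (L b)"])
    with B(2) show False by contradiction
  qed
  have "y \<in> span (L ` B)"
  proof (rule ccontr)
    assume y': "y \<notin> span (L ` B)"
    then have "y \<notin> L ` B" using span_base by blast
    have "independent (insert y (L ` B))" using y' ind by (simp add: independent_insert)
    moreover have "insert y (L ` B) \<subseteq> span B" using y into BS sp by auto
    ultimately have "card (insert y (L ` B)) \<le> card B"
      using independent_span_bound[OF fin] by blast
    then show False using \<open>y \<notin> L ` B\<close> fin by (simp add: card_image inj)
  qed
  then show ?thesis
  proof (induction rule: span_induct_alt)
    case base
    then show ?case using L0 span_zero by blast
  next
    case (step a z w)
    then obtain b x where "b \<in> B" "z = L b" "x \<in> span S" "L x = w" by blast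
    then show ?case
      using lin[of b x a] BS by (intro bexI[of _ "scale a b + x"]) (auto intro: span_add span_scale)
  qed
qed

section \<open>Polynomials of bounded degree as a finite-dimensional space\<close>

interpretation fn: vector_space "\<lambda>(a :: real) (f :: 'a \<Rightarrow> real) x. a * f x"
  by unfold_locales (auto simp: fun_eq_iff algebra_simps)

text \<open>Since 1 is put in again at each stage, these are all monomials of degree at most
  \<open>k\<close>, and not only those of degree exactly \<open>k\<close>.\<close>

primrec monomials :: "nat \<Rightarrow> (real ^ 'n \<Rightarrow> real) set" where
  "monomials 0 = {\<lambda>x. 1}"
| "monomials (Suc k) = insert (\<lambda>x. 1) (\<Union>i. (\<lambda>m x. x $ i * m x) ` monomials k)"

definition polys :: "nat \<Rightarrow> (real ^ 'n \<Rightarrow> real) set" where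
  "polys k = fn.span (monomials k)"

lemma finite_monomials: "finite (monomials k)"
  by (induction k) auto

lemma monomials_Suc: "monomials k \<subseteq> monomials (Suc k)"
proof (induction k)
  case (Suc k)
  show ?case
    unfolding monomials.simps(2)[of k] monomials.simps(2)[of "Suc k"]
    by (intro insert_mono UN_mono image_mono Suc[unfolded monomials.simps(2)] subset_refl)
qed auto

lemma polys_mono: "k \<le> l \<Longrightarrow> polys k \<subseteq> polys l"
  unfolding polys_def by (rule fn.span_mono, rule lift_Suc_mono_le[where f = monomials, OF monomials_Suc])

lemma polys_add: "p \<in> polys k \<Longrightarrow> q \<in> polys k \<Longrightarrow> (\<lambda>x. p x + q x) \<in> polys k"
  unfolding polys_def by (drule (1) fn.span_add) (simp add: plus_fun_def)

lemma polys_cmult: "p \<in> polys k \<Longrightarrow> (\<lambda>x. a * p x) \<in> polys k"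
  unfolding polys_def by (rule fn.span_scale)

lemma polys_const: "(\<lambda>x. a) \<in> polys k"
proof -
  have "(\<lambda>x. 1) \<in> polys k"
    unfolding polys_def by (rule fn.span_base) (cases k, auto)
  from polys_cmult[OF this, of a] show ?thesis by simp
qed

lemma polys_sum: "finite A \<Longrightarrow> (\<And>i. i \<in> A \<Longrightarrow> p i \<in> polys k) \<Longrightarrow> (\<lambda>x. \<Sum>i\<in>A. p i x) \<in> polys k"
  by (induction A rule: finite_induct) (auto intro: polys_const polys_add)

lemma polys_induct [consumes 1, case_names zero step]:
  assumes "p \<in> polys k" "P (\<lambda>x. 0)"
    and "\<And>a m q. m \<in> monomials k \<Longrightarrow> q \<in> polys k \<Longrightarrow> P q \<Longrightarrow> P (\<lambda>x. a * m x + q x)"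
  shows "P p"
proof -
  have "p \<in> polys k \<and> P p"
    using assms(1) unfolding polys_def
  proof (induction rule: fn.span_induct_alt)
    case base
    then show ?case using assms(2) fn.span_zero by (simp add: zero_fun_def)
  next
    case (step a m q)
    then have "(\<lambda>x. a * m x) + q \<in> fn.span (monomials k)"
      by (intro fn.span_add fn.span_scale) (auto intro: fn.span_base)
    then show ?case using assms(3)[of m q a] step by (simp add: plus_fun_def polys_def)
  qed
  then show ?thesis ..
qed

lemma polys_coord_mult: "p \<in> polys k \<Longrightarrow> (\<lambda>x. x $ i * p x) \<in> polys (Suc k)"
proof (induction rule: polys_induct)
  case zero
  then show ?case by (simp add: polys_const)
next
  case (step a m q)
  have "(\<lambda>x. x $ i * m x) \<in> polys (Suc k)"
    unfolding polys_def using step by (intro fn.span_base) auto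
  from polys_add[OF polys_cmult[OF this, of a] step(3)] show ?case
    by (simp add: algebra_simps)
qed

lemma polys_mult: "p \<in> polys k \<Longrightarrow> q \<in> polys l \<Longrightarrow> (\<lambda>x. p x * q x) \<in> polys (k + l)"
proof (induction rule: polys_induct)
  case zero
  then show ?case by (simp add: polys_const)
next
  case (step a m p)
  have "(\<lambda>x. m x * q x) \<in> polys (k + l)" if "m \<in> monomials k" for m k
    using that
  proof (induction k arbitrary: m)
    case 0
    then show ?case using step by simp
  next
    case (Suc k)
    then show ?case
    proof (cases "m = (\<lambda>x. 1)")
      case True
      then show ?thesis using step polys_mono[of l "Suc k + l"] by auto
    next
      case False
      with Suc obtain i m' where "m = (\<lambda>x. x $ i * m' x)" "m' \<in> monomials k" by auto
      then show ?thesis using polys_coord_mult[OF Suc(1), of m' i] by (simp add: mult.assoc)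
    qed
  qed
  from polys_add[OF polys_cmult[OF this[OF step(1)], of a] step(3)[OF step(4)]] show ?case
    by (simp add: algebra_simps)
qed

lemma polys_partial:
  assumes "p \<in> polys k"
  shows "\<exists>d\<in>polys (k - 1). \<forall>x. has_partial i p x (d x)"
  using assms
proof (induction rule: polys_induct)
  case zero
  show ?case using has_partial_const by (intro bexI[of _ "\<lambda>x. 0"] allI polys_const)
next
  case (step a m q)
  \<comment> \<open>The extra clause serves degree zero: there \<open>k - 1\<close> is again 0, so
    the bound \<open>d \<in> polys (k - 1)\<close> alone would let \<open>x $ l * d x\<close> have
    degree one where only degree zero is allowed.\<close>
  have "\<exists>d\<in>polys (k - 1). (k = 0 \<longrightarrow> d = (\<lambda>x. 0)) \<and> (\<forall>x. has_partial i m x (d x))"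
    using step(1)
  proof (induction k arbitrary: m)
    case 0
    then show ?case using has_partial_const polys_const by (intro bexI[of _ "\<lambda>x. 0"]) auto
  next
    case (Suc k)
    show ?case
    proof (cases "m = (\<lambda>x. 1)")
      case True
      then show ?thesis using has_partial_const polys_const by (intro bexI[of _ "\<lambda>x. 0"]) auto
    next
      case False
      with Suc obtain l m' where m: "m = (\<lambda>x. x $ l * m' x)" "m' \<in> monomials k" by auto
      from Suc(1)[OF this(2)] obtain d where
        d: "d \<in> polys (k - 1)" "k = 0 \<longrightarrow> d = (\<lambda>x. 0)" "\<And>x. has_partial i m' x (d x)" by blast
      have "(\<lambda>x. x $ l * d x) \<in> polys k"
        using d polys_coord_mult[OF d(1), of l] by (cases k) (auto simp: polys_const)
      moreover have "(\<lambda>x. (if i = l then 1 else 0) * m' x) \<in> polys k"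
        using m(2) unfolding polys_def by (intro fn.span_scale fn.span_base)
      ultimately have "(\<lambda>x. (if i = l then 1 else 0) * m' x + x $ l * d x) \<in> polys k"
        by (intro polys_add)
      moreover have "has_partial i m x ((if i = l then 1 else 0) * m' x + x $ l * d x)" for x
        unfolding m(1) using has_partial_mult[OF has_partial_coord[of i l 0 x] d(3)[of x]] by simp
      ultimately show ?thesis
        by (intro bexI[of _ "\<lambda>x. (if i = l then 1 else 0) * m' x + x $ l * d x"]) auto
    qed
  qed
  then obtain d where d: "d \<in> polys (k - 1)" "\<And>x. has_partial i m x (d x)" by blast
  from step(3) obtain e where e: "e \<in> polys (k - 1)" "\<And>x. has_partial i q x (e x)" by blast
  from d e show ?case
    by (intro bexI[of _ "\<lambda>x. a * d x + e x"] allI has_partial_add has_partial_cmult polys_add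
        polys_cmult)
qed

lemma partial_in_polys:
  assumes "p \<in> polys k" shows "partial i p \<in> polys (k - 1)"
proof -
  obtain d where d: "d \<in> polys (k - 1)" "\<And>x. has_partial i p x (d x)"
    using polys_partial[OF assms] by blast
  then have "partial i p = d" using has_partial_imp_partial by blast
  with d show ?thesis by simp
qed

text \<open>\<open>real_polynomial_function\<close> is what Stone-Weierstrass delivers,
  \<open>polys k\<close> is what has finite dimension; this lemma and its converse switch between
  them.\<close>

lemma real_polynomial_function_imp_polys:
  fixes p :: "real ^ 'n \<Rightarrow> real"
  assumes "real_polynomial_function p" shows "\<exists>k. p \<in> polys k"
  using assms
proof (induction rule: real_polynomial_function.induct)
  case (linear f)
  have "f x = (\<Sum>i\<in>UNIV. f (axis i 1) * (x $ i * 1))" for x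
  proof -
    have "f x = f (\<Sum>i\<in>UNIV. x $ i *\<^sub>R axis i 1)"
      using basis_expansion[of x] by (simp add: scalar_mult_eq_scaleR)
    also have "\<dots> = (\<Sum>i\<in>UNIV. f (axis i 1) * (x $ i * 1))"
      using linear by (simp add: bounded_linear.linear linear_sum linear_cmul mult.commute)
    finally show ?thesis .
  qed
  then have "f = (\<lambda>x. \<Sum>i\<in>UNIV. f (axis i 1) * (x $ i * 1))" by blast
  also have "\<dots> \<in> polys (Suc 0)"
    by (intro polys_sum polys_cmult polys_coord_mult polys_const) auto
  finally show ?case by blast
next
  case (const c)
  show ?case using polys_const by blast
next
  case (add f g)
  then obtain k l where "f \<in> polys k" "g \<in> polys l" by blast
  then have "f \<in> polys (k + l)" "g \<in> polys (k + l)"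
    using polys_mono[of k "k + l"] polys_mono[of l "k + l"] by auto
  then show ?case using polys_add by blast
next
  case (mult f g)
  then show ?case using polys_mult by blast
qed

lemma polys_imp_real_polynomial_function:
  fixes p :: "real ^ 'n \<Rightarrow> real"
  assumes "p \<in> polys k" shows "real_polynomial_function p"
  using assms
proof (induction rule: polys_induct)
  case (step a m q)
  have "real_polynomial_function m" using step(1)
  proof (induction k arbitrary: m)
    case (Suc k)
    then show ?case
      using real_polynomial_function.intros(4)[OF real_polynomial_function.intros(1)[OF bounded_linear_vec_nth]]
      by (auto intro: real_polynomial_function.intros(2))
  qed auto
  then show ?case
    using step by (intro real_polynomial_function.intros(3,4)) (auto intro: real_polynomial_function.intros(2))
qed auto

lemma polynomial_has_partial:
  fixes p :: "real ^ 'n \<Rightarrow> real"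
  assumes "real_polynomial_function p"
  shows "has_partial i p x (partial i p x)" "real_polynomial_function (partial i p)"
proof -
  obtain k where k: "p \<in> polys k" using real_polynomial_function_imp_polys[OF assms] by blast
  then show "has_partial i p x (partial i p x)"
    using polys_partial[OF k, of i] has_partial_imp_partial by metis
  show "real_polynomial_function (partial i p)"
    using partial_in_polys[OF k] by (rule polys_imp_real_polynomial_function)
qed

lemma polynomial_C2:
  fixes p :: "real ^ 'n \<Rightarrow> real"
  assumes "real_polynomial_function p" shows "C_k_on 2 p S"
proof -
  have cont: "continuous_on S q" if "real_polynomial_function q" for q :: "real ^ 'n \<Rightarrow> real"
    using that by (simp add: real_polynomial_function_eq continuous_on_polymonial_function)
  show ?thesis
    using assms by (auto simp: numeral_2_eq_2 has_partial_at_iff polynomial_has_partial cont)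
qed

lemma partial_add:
  fixes p :: "real ^ 'n \<Rightarrow> real"
  assumes "real_polynomial_function p" "real_polynomial_function q"
  shows "partial i (\<lambda>x. p x + q x) = (\<lambda>x. partial i p x + partial i q x)"
  using assms by (auto intro!: has_partial_imp_partial has_partial_add polynomial_has_partial)

lemma partial_mult:
  fixes p :: "real ^ 'n \<Rightarrow> real"
  assumes "real_polynomial_function p" "real_polynomial_function q"
  shows "partial i (\<lambda>x. p x * q x) = (\<lambda>x. partial i p x * q x + p x * partial i q x)"
  using assms by (auto intro!: has_partial_imp_partial has_partial_mult polynomial_has_partial)

lemma partial_const: "partial i (\<lambda>x. c) = (\<lambda>x. 0)"
  by (auto intro!: has_partial_imp_partial has_partial_const)

text \<open>For polynomials the symmetry is algebraic: linear forms have constant derivatives, and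
  the sum and product rules pass the property on.\<close>

lemma partial_commute:
  fixes p :: "real ^ 'n \<Rightarrow> real"
  assumes "real_polynomial_function p"
  shows "partial i (partial j p) = partial j (partial i p)"
  using assms
proof (induction rule: real_polynomial_function.induct)
  case (linear f)
  have "partial k f = (\<lambda>x. f (axis k 1))" for k
    using linear by (auto intro!: has_partial_imp_partial has_partial_linear)
  then show ?case by (simp add: partial_const)
next
  case (const c)
  show ?case by (simp add: partial_const)
next
  case (add f g)
  then show ?case by (simp add: partial_add polynomial_has_partial)
next
  case (mult f g)
  then show ?case
    by (simp add: partial_add partial_mult polynomial_has_partial real_polynomial_function.intros(4)
        algebra_simps)
qed

text \<open>Differentiate \<open>laplacian p = 0\<close> and commute the derivatives. This allows
  the bound on first derivatives to be applied once more, to reach second derivatives.\<close>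

lemma harmonic_partial:
  fixes p :: "real ^ 'n \<Rightarrow> real"
  assumes p: "real_polynomial_function p" and "harmonic_on UNIV p"
  shows "harmonic_on UNIV (partial i p)"
proof -
  have lap: "(\<lambda>x. \<Sum>j\<in>UNIV. partial j (partial j p) x) = (\<lambda>x. 0)"
    using assms(2) by (simp add: harmonic_on_def laplacian_def)
  have "laplacian (partial i p) x = 0" for x
  proof -
    have "laplacian (partial i p) x = (\<Sum>j\<in>UNIV. partial i (partial j (partial j p)) x)"
      unfolding laplacian_def
      using p by (intro sum.cong refl) (metis partial_commute polynomial_has_partial(2))
    also have "\<dots> = 0"
    proof -
      have "has_partial i (\<lambda>x. \<Sum>j\<in>UNIV. partial j (partial j p) x) x
          (\<Sum>j\<in>UNIV. partial i (partial j (partial j p)) x)"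
        using p by (intro has_partial_sum polynomial_has_partial) auto
      then show ?thesis unfolding lap using has_partial_const has_partial_imp_partial by metis
    qed
    finally show ?thesis .
  qed
  then show ?thesis
    using p by (simp add: harmonic_on_def polynomial_C2 polynomial_has_partial)
qed

text \<open>Along \<open>c + t *\<^sub>R (x - c)\<close> the polynomial depends on the single
  variable \<open>t\<close> and has infinitely many zeros near 0, so all its coefficients vanish;
  \<open>t = 1\<close> gives \<open>x\<close>.\<close>

lemma polynomial_zero_on_ball_imp_zero:
  fixes s :: "real ^ 'n \<Rightarrow> real"
  assumes s: "real_polynomial_function s" and "r > 0" and z: "\<And>x. x \<in> ball c r \<Longrightarrow> s x = 0"
  shows "s x = 0"
proof -
  have "polynomial_function (\<lambda>t::real. c + t *\<^sub>R (x - c))"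
    by (intro polynomial_function_add polynomial_function_const polynomial_function_bounded_linear
        bounded_linear_scaleR_left)
  then have "real_polynomial_function (\<lambda>t. s (c + t *\<^sub>R (x - c)))"
    using real_polynomial_function_compose[OF _ s] by (simp add: o_def)
  then obtain a n where a: "\<And>t. s (c + t *\<^sub>R (x - c)) = (\<Sum>i\<le>n. a i * t ^ i)"
    unfolding real_polynomial_function_iff_sum by metis
  define \<delta> where "\<delta> = r / (norm (x - c) + 1)"
  have \<delta>: "\<delta> > 0" using \<open>r > 0\<close> by (simp add: \<delta>_def add_nonneg_pos)
  have "(\<Sum>i\<le>n. a i * t ^ i) = 0" if t: "0 < t" "t < \<delta>" for t
  proof -
    have "norm (t *\<^sub>R (x - c)) \<le> t * (norm (x - c) + 1)" using t by (simp add: mult_left_mono)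
    also have "\<dots> < \<delta> * (norm (x - c) + 1)" using t by (intro mult_strict_right_mono) (auto simp: add_nonneg_pos)
    also have "\<dots> = r" by (simp add: \<delta>_def add_nonneg_eq_0_iff)
    finally have "c + t *\<^sub>R (x - c) \<in> ball c r" by (simp add: dist_norm)
    then show ?thesis using z a by metis
  qed
  then have "{0<..<\<delta>} \<subseteq> {t. (\<Sum>i\<le>n. a i * t ^ i) = 0}" by auto
  then have "infinite {t. (\<Sum>i\<le>n. a i * t ^ i) = 0}"
    using infinite_Ioo[OF \<delta>] finite_subset by blast
  then have "a i = 0" if "i \<le> n" for i using polyfun_rootbound[where c = a and n = n] that by blast
  then show ?thesis using a[of 1] by simp
qed

lemma harmonic_polynomial_on_ball:
  fixes p :: "real ^ 'n \<Rightarrow> real"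
  assumes p: "real_polynomial_function p" and r: "r > 0"
  shows "\<exists>q. real_polynomial_function q \<and> harmonic_on UNIV q \<and> (\<forall>x\<in>sphere c r. q x = p x)"
proof -
  define Q :: "real ^ 'n \<Rightarrow> real" where "Q = (\<lambda>x. r\<^sup>2 - (norm (x - c))\<^sup>2)"
  define L where "L = (\<lambda>s x. laplacian (\<lambda>x. Q x * s x) x)"
  have Q: "Q \<in> polys 2"
  proof -
    have l: "(\<lambda>x. x $ i * 1 + - (c $ i)) \<in> polys (Suc 0)" for i
      by (intro polys_add polys_coord_mult polys_const)
    have *: "(\<lambda>x. r\<^sup>2 + (\<Sum>i\<in>UNIV. -1 * ((x $ i * 1 + - (c $ i)) * (x $ i * 1 + - (c $ i))))) \<in> polys (Suc 0 + Suc 0)"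
      by (rule polys_add[OF polys_const polys_sum[OF _ polys_cmult[OF polys_mult[OF l l]]]]) simp
    have "Q = (\<lambda>x. r\<^sup>2 + (\<Sum>i\<in>UNIV. -1 * ((x $ i * 1 + - (c $ i)) * (x $ i * 1 + - (c $ i)))))"
      unfolding Q_def norm_sq_vec by (simp add: power2_eq_square sum_negf)
    with * show ?thesis by (simp add: numeral_2_eq_2)
  qed
  have C2Q: "C_k_on 2 (\<lambda>x. Q x * s x) UNIV" if "s \<in> polys k" for s k
    using polys_mult[OF Q that] by (intro polynomial_C2 polys_imp_real_polynomial_function)
  \<comment> \<open>Multiplying by \<open>Q\<close> raises the degree by two and the Laplacian
    lowers it by two, so \<open>L\<close> maps \<open>polys k\<close> into itself.\<close>
  have Lpolys: "L s \<in> polys k" if "s \<in> polys k" for s k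
  proof -
    have "(\<lambda>x. Q x * s x) \<in> polys (k + 2)" using polys_mult[OF Q that] by (simp add: add.commute)
    then have "partial i (partial i (\<lambda>x. Q x * s x)) \<in> polys k" for i
      using partial_in_polys[OF partial_in_polys] by fastforce
    then show ?thesis unfolding L_def laplacian_def by (intro polys_sum) auto
  qed
  obtain k where k: "p \<in> polys k" using real_polynomial_function_imp_polys[OF p] by blast
  have "laplacian p \<in> polys k"
    unfolding laplacian_def
    using polys_mono[of "k - 1 - 1" k] partial_in_polys[OF partial_in_polys[OF k]] by (intro polys_sum) auto
  then have lp: "(\<lambda>x. -1 * laplacian p x) \<in> polys k" by (rule polys_cmult)
  have "\<exists>s\<in>fn.span (monomials k). L s = (\<lambda>x. -1 * laplacian p x)"
  proof (rule fn.injective_imp_surjective_on_span[OF finite_monomials])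
    show "L s \<in> fn.span (monomials k)" if "s \<in> fn.span (monomials k)" for s
      using Lpolys that unfolding polys_def .
    show "L ((\<lambda>x. a * s x) + t) = (\<lambda>x. a * L s x) + L t"
      if "s \<in> fn.span (monomials k)" "t \<in> fn.span (monomials k)" for a s t
    proof
      fix x
      have "(\<lambda>x. Q x * ((\<lambda>x. a * s x) + t) x) = (\<lambda>x. a * (Q x * s x) + Q x * t x)"
        by (simp add: algebra_simps)
      then show "L ((\<lambda>x. a * s x) + t) x = ((\<lambda>x. a * L s x) + L t) x"
        using C2Q that[folded polys_def]
        by (simp add: L_def laplacian_add[where S = UNIV] laplacian_cmult[where S = UNIV] C2_cmult)
    qed
    \<comment> \<open>\<open>Q * s\<close> vanishes on the sphere; being harmonic, it vanishes in
      the ball. There \<open>Q > 0\<close>, which leaves \<open>s = 0\<close> on the ball and then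
      everywhere.\<close>
    show "s = 0" if s: "s \<in> fn.span (monomials k)" "L s = 0" for s
    proof -
      note sk = s(1)[folded polys_def]
      have h: "harmonic_on UNIV (\<lambda>x. Q x * s x)"
        using C2Q[OF sk] s(2) by (auto simp: harmonic_on_def L_def fun_eq_iff)
      have "s x = 0" if "x \<in> ball c r" for x
      proof -
        have "\<bar>Q x * s x\<bar> \<le> 0"
        proof (rule harmonic_bound[OF open_ball bounded_ball])
          show "continuous_on (closure (ball c r)) (\<lambda>x. Q x * s x)"
            using C2_continuous[OF C2Q[OF sk]] continuous_on_subset by blast
          show "harmonic_on (ball c r) (\<lambda>x. Q x * s x)" using harmonic_on_subset[OF h] by blast
          show "\<bar>Q x * s x\<bar> \<le> 0" if "x \<in> frontier (ball c r)" for x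
            using that r by (simp add: Q_def dist_norm norm_minus_commute)
          show "x \<in> closure (ball c r)" using that closure_subset by blast
        qed
        moreover have "Q x > 0"
          using that by (auto simp: Q_def dist_norm norm_minus_commute intro!: power_strict_mono)
        ultimately show ?thesis by simp
      qed
      then have "s x = 0" for x
        using polynomial_zero_on_ball_imp_zero[OF polys_imp_real_polynomial_function[OF sk] r] by blast
      then show ?thesis by auto
    qed
    show "(\<lambda>x. -1 * laplacian p x) \<in> fn.span (monomials k)" using lp unfolding polys_def .
  qed
  then obtain s where s: "s \<in> polys k" "L s = (\<lambda>x. -1 * laplacian p x)"
    unfolding polys_def by blast
  \<comment> \<open>\<open>Q\<close> vanishes on the sphere, so the second summand cancels the
    Laplacian of \<open>p\<close> without touching the boundary values.\<close>
  define q where "q = (\<lambda>x. p x + Q x * s x)"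
  have "real_polynomial_function q"
    unfolding q_def
    by (rule real_polynomial_function.intros(3)[OF p polys_imp_real_polynomial_function[OF polys_mult[OF Q s(1)]]])
  moreover have "laplacian q x = 0" for x
    using laplacian_add[OF open_UNIV polynomial_C2[OF p] C2Q[OF s(1)], of x] fun_cong[OF s(2), of x]
    by (simp add: q_def L_def)
  moreover have "q x = p x" if "x \<in> sphere c r" for x
    using that by (simp add: q_def Q_def dist_norm norm_minus_commute)
  ultimately show ?thesis by (auto simp: harmonic_on_def polynomial_C2)
qed

section \<open>Interior estimates and the Dirichlet problem on balls\<close>

lemma has_partial_diff:
  "has_partial i u x a \<Longrightarrow> has_partial i v x b \<Longrightarrow> has_partial i (\<lambda>x. u x - v x) x (a - b)"
  unfolding has_partial_def by (rule DERIV_diff)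

definition reflect :: "'n \<Rightarrow> real \<Rightarrow> real ^ 'n \<Rightarrow> real ^ 'n" where
  "reflect k a x = x - (2 * (x $ k - a)) *\<^sub>R axis k 1"

lemma reflect_nth: "reflect k a x $ i = (if i = k then 2 * a - x $ k else x $ i)"
  by (auto simp: reflect_def axis_def)

lemma continuous_on_reflect: "continuous_on S (reflect k a)"
  unfolding reflect_def[abs_def] by (intro continuous_intros)

lemma has_partial_reflect:
  assumes "has_partial i f (reflect k a x) D"
  shows "has_partial i (\<lambda>x. f (reflect k a x)) x ((if i = k then -1 else 1) * D)"
proof -
  let ?\<sigma> = "if i = k then -1 else 1 :: real"
  have "reflect k a (x + t *\<^sub>R axis i 1) = reflect k a x + (?\<sigma> * t) *\<^sub>R axis i 1" for t
    by (auto simp: vec_eq_iff reflect_nth axis_def)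
  moreover have "((\<lambda>t. f (reflect k a x + (?\<sigma> * t) *\<^sub>R axis i 1)) has_real_derivative D * ?\<sigma>) (at 0)"
    by (rule DERIV_chain2[where f = "\<lambda>t. f (reflect k a x + t *\<^sub>R axis i 1)"])
      (use assms in \<open>auto simp: has_partial_def intro!: derivative_eq_intros\<close>)
  ultimately show ?thesis by (simp add: has_partial_def mult.commute)
qed

text \<open>Reflection changes the sign of first derivatives in direction \<open>k\<close> only, and
  in the pure second derivatives that sign enters squared.\<close>

lemma harmonic_reflect:
  assumes "open S" "harmonic_on S u"
  shows "harmonic_on (reflect k a -` S) (\<lambda>x. u (reflect k a x))"
proof -
  let ?\<sigma> = "\<lambda>i. if i = k then -1 else 1 :: real" and ?T = "reflect k a -` S"
  have T: "open ?T" using assms(1) continuous_on_reflect by (intro open_vimage) 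
  have C2: "C_k_on 2 u S" using assms(2) by (simp add: harmonic_on_def)
  note u = C2_with_partials[OF C2, unfolded C2_with_def]
  have c: "continuous_on ?T (\<lambda>x. f (reflect k a x))" if "continuous_on S f" for f :: "_ \<Rightarrow> real"
    using continuous_on_compose2[OF that continuous_on_reflect] by auto
  have *: "C2_with ?T (\<lambda>x. u (reflect k a x)) (\<lambda>i x. ?\<sigma> i * partial i u (reflect k a x))
     (\<lambda>i j x. ?\<sigma> i * (?\<sigma> j * partial j (partial i u) (reflect k a x)))"
    unfolding C2_with_def
    by (intro conjI allI ballI continuous_intros c has_partial_reflect has_partial_cmult)
      (use u in auto)
  have "?\<sigma> i * (?\<sigma> i * y) = y" for i y by simp
  with C2_withD(1,2)[OF T *] have "C_k_on 2 (\<lambda>x. u (reflect k a x)) ?T"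
    "\<And>x. x \<in> ?T \<Longrightarrow> laplacian (\<lambda>x. u (reflect k a x)) x = laplacian u (reflect k a x)"
    by (simp_all add: laplacian_def[of u])
  then show ?thesis using assms(2) by (simp add: harmonic_on_def)
qed

text \<open>
  On the half cube beyond the hyperplane \<open>x$k = c$k\<close>, the antisymmetrization of \<open>u\<close> under
  reflection vanishes on the hyperplane and is therefore dominated by an explicit harmonic
  quadratic polynomial that is linear in the distance to the hyperplane along the axis.
\<close>

lemma harmonic_axis_difference_le:
  fixes u :: "real ^ 'n \<Rightarrow> real"
  assumes "open S" "harmonic_on S u" "0 < t" "t < d"
    and S: "\<And>x. (\<And>i. \<bar>x $ i - c $ i\<bar> \<le> d) \<Longrightarrow> x \<in> S"
    and M: "\<And>x. (\<And>i. \<bar>x $ i - c $ i\<bar> \<le> d) \<Longrightarrow> \<bar>u x\<bar> \<le> M"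
  shows "u (c + t *\<^sub>R axis k 1) - u (c - t *\<^sub>R axis k 1) \<le> 2 * real CARD('n) * M * t / d"
proof -
  \<comment> \<open>The box from \<open>a\<close> to \<open>b\<close> is the half
    \<open>x $ k \<ge> c $ k\<close> of the cube with half side \<open>d\<close> about
    \<open>c\<close>.\<close>
  define a :: "real ^ 'n" where "a = (\<chi> i. if i = k then c $ i else c $ i - d)"
  define b :: "real ^ 'n" where "b = (\<chi> i. c $ i + d)"
  define n where "n = real CARD('n)"
  have n: "n \<ge> 1" by (simp add: n_def Suc_leI)
  have d: "d > 0" using assms by simp
  \<comment> \<open>Three requirements fix this function. The Laplacian \<open>2 * n\<close> of the
    squared norm is cancelled by \<open>- n\<close> times the squared coordinate; the linear term
    with factor \<open>n * d\<close> makes the coordinate part nonnegative on the half cube; the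
    prefactor brings \<open>\<psi>\<close> to at least \<open>2 * M\<close> wherever some coordinate
    is at distance \<open>d\<close> from that of \<open>c\<close>.\<close>
  define \<psi> where "\<psi> = (\<lambda>x. (2 * M / d\<^sup>2) * ((norm (x - c))\<^sup>2 + (n * d) * (x $ k - c $ k) - n * (x $ k - c $ k)\<^sup>2))"
  define w where "w = (\<lambda>x. (u x - u (reflect k (c $ k) x)) - \<psi> x)"
  have M0: "M \<ge> 0" using M[of c] d by auto
  have V: "\<bar>x $ i - c $ i\<bar> \<le> d" "x $ k \<ge> c $ k" "x $ k \<le> c $ k + d" if "x \<in> cbox a b" for x i
  proof -
    have "a $ i \<le> x $ i" "x $ i \<le> b $ i" for i using that by (auto simp: mem_box_cart)
    from this[of i] this[of k] show "\<bar>x $ i - c $ i\<bar> \<le> d" "x $ k \<ge> c $ k" "x $ k \<le> c $ k + d"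
      using d by (auto simp: a_def b_def split: if_splits)
  qed
  have V': "\<bar>reflect k (c $ k) x $ i - c $ i\<bar> \<le> d" if "x \<in> cbox a b" for x i
    using V(1)[OF that, of i] by (auto simp: reflect_nth)
  have sub: "cbox a b \<subseteq> S \<inter> reflect k (c $ k) -` S"
    using S V(1) V' by auto
  have "harmonic_on UNIV \<psi>"
  proof -
    let ?q = "\<lambda>x. (norm (x - c))\<^sup>2 + (n * d) * (x $ k - c $ k) - n * (x $ k - c $ k)\<^sup>2"
    have q: "C_k_on 2 ?q UNIV"
      by (intro C2_cmult C2_diff C2_add C2_norm_sq C2_coord C2_coord_sq open_UNIV)
    then have "C_k_on 2 \<psi> UNIV" unfolding \<psi>_def by (intro C2_cmult open_UNIV)
    moreover have "laplacian ?q x = 0" for x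
      by (simp add: laplacian_cmult[where S = UNIV] laplacian_diff[where S = UNIV]
          laplacian_add[where S = UNIV] C2_cmult C2_diff C2_add C2_norm_sq C2_coord C2_coord_sq
          laplacian_norm_sq laplacian_coord laplacian_coord_sq n_def)
    then have "laplacian \<psi> x = 0" for x
      unfolding \<psi>_def by (subst laplacian_cmult[OF open_UNIV q UNIV_I]) simp
    ultimately show ?thesis by (simp add: harmonic_on_def)
  qed
  then have w: "harmonic_on (S \<inter> reflect k (c $ k) -` S) w"
    unfolding w_def using assms(1) continuous_on_reflect
    by (intro harmonic_on_diff open_Int open_vimage)
      (auto intro: harmonic_on_subset[OF assms(2)] harmonic_on_subset[OF harmonic_reflect[OF assms(1,2)]]
        harmonic_on_subset)
  let ?x = "c + t *\<^sub>R axis k 1"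
  have cl: "closure (box a b) \<subseteq> cbox a b" by (intro closure_minimal box_subset_cbox closed_cbox)
  have "w ?x \<le> 0"
  proof (rule maximum_principle[OF open_box bounded_box])
    show "continuous_on (closure (box a b)) w"
      using w cl sub by (meson C2_continuous continuous_on_subset harmonic_on_def)
    have wb: "harmonic_on (box a b) w"
      using harmonic_on_subset[OF w] sub box_subset_cbox by blast
    then show "C_k_on 2 w (box a b)" "\<And>x. x \<in> box a b \<Longrightarrow> 0 \<le> laplacian w x"
      by (auto simp: harmonic_on_def)
    have "?x \<in> box a b" using assms(3,4) by (auto simp: mem_box_cart a_def b_def axis_def)
    then show "?x \<in> closure (box a b)" using closure_subset by blast
    fix x assume "x \<in> frontier (box a b)"
    then have x: "x \<in> cbox a b" "x \<notin> box a b"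
      using cl interior_open[OF open_box[of a b]] by (auto simp: frontier_def)
    define s where "s = x $ k - c $ k"
    have s: "0 \<le> s" "s \<le> d" using V[OF x(1)] by (auto simp: s_def)
    have ns: "n * d * s - n * s\<^sup>2 \<ge> 0"
    proof -
      have "n * d * s - n * s\<^sup>2 = n * s * (d - s)" by (simp add: power2_eq_square algebra_simps)
      then show ?thesis using s n by simp
    qed
    have \<psi>: "\<psi> x = (2 * M / d\<^sup>2) * ((norm (x - c))\<^sup>2 + (n * d * s - n * s\<^sup>2))"
      by (simp add: \<psi>_def s_def)
    \<comment> \<open>Frontier points lie on a face. On the flat one the antisymmetrized part of
      \<open>w\<close> vanishes and \<open>\<psi> \<ge> 0\<close>; on the others that part is at
      most \<open>2 * M\<close>, hence at most \<open>\<psi>\<close>.\<close>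
    from x obtain i where i: "x $ i = a $ i \<or> x $ i = b $ i"
      unfolding mem_box_cart by (metis order_le_imp_less_or_eq)
    show "w x \<le> 0"
    proof (cases "i = k \<and> x $ i = a $ i")
      case True
      then have "x $ k = c $ k" by (auto simp: a_def)
      then have "reflect k (c $ k) x = x" by (simp add: reflect_def)
      moreover have "\<psi> x \<ge> 0" unfolding \<psi> using M0 ns by (intro mult_nonneg_nonneg add_nonneg_nonneg) auto
      ultimately show ?thesis by (simp add: w_def)
    next
      case False
      then have "\<bar>x $ i - c $ i\<bar> = d" using i d by (auto simp: a_def b_def)
      then have "d \<le> norm (x - c)" using component_le_norm_cart[of "x - c" i] by simp
      then have "d\<^sup>2 \<le> (norm (x - c))\<^sup>2 + (n * d * s - n * s\<^sup>2)"
        using ns d power_mono[of d "norm (x - c)" 2] by linarith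
      then have "(2 * M / d\<^sup>2) * d\<^sup>2 \<le> \<psi> x" unfolding \<psi> using M0 by (intro mult_left_mono) auto
      then have "2 * M \<le> \<psi> x" using d by simp
      moreover have "\<bar>u x\<bar> \<le> M" "\<bar>u (reflect k (c $ k) x)\<bar> \<le> M"
        using M V(1)[OF x(1)] V'[OF x(1)] by auto
      ultimately show ?thesis unfolding w_def by linarith
    qed
  qed
  moreover have "reflect k (c $ k) ?x = c - t *\<^sub>R axis k 1"
    by (auto simp: vec_eq_iff reflect_nth axis_def)
  moreover have "\<psi> ?x \<le> 2 * n * M * t / d"
  proof -
    have "\<psi> ?x = (2 * M / d\<^sup>2) * (t\<^sup>2 + n * d * t - n * t\<^sup>2)"
      by (simp add: \<psi>_def norm_axis_1 axis_nth)
    \<comment> \<open>The quadratic terms combine to \<open>(1 - n) * t\<^sup>2 \<le> 0\<close>, and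
      only the term linear in \<open>t\<close> survives.\<close>
    also have "\<dots> \<le> (2 * M / d\<^sup>2) * (n * d * t)"
      using M0 n mult_right_mono[of 1 n "t\<^sup>2"] by (intro mult_left_mono) auto
    also have "\<dots> = 2 * n * M * t / d" using d by (simp add: power2_eq_square)
    finally show ?thesis .
  qed
  ultimately show ?thesis by (simp add: w_def n_def)
qed

text \<open>With \<open>n\<close> the dimension, points of the cube of half side
  \<open>R / (2 * n)\<close> have l1 distance at most \<open>R / 2\<close> from \<open>c\<close>, so
  the cube fits into the ball. The one-sided estimate for \<open>u\<close> and \<open>- u\<close>
  gives the absolute value.\<close>

lemma harmonic_axis_difference:
  fixes u :: "real ^ 'n \<Rightarrow> real"
  assumes u: "harmonic_on (ball c R) u" and M: "\<And>x. x \<in> ball c R \<Longrightarrow> \<bar>u x\<bar> \<le> M"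
    and t: "0 \<le> t" "t < R / (2 * real CARD('n))"
  shows "\<bar>u (c + t *\<^sub>R axis k 1) - u (c - t *\<^sub>R axis k 1)\<bar> \<le> 4 * (real CARD('n))\<^sup>2 * M * t / R"
proof (cases "t = 0")
  case False
  with t have t: "0 < t" "t < R / (2 * real CARD('n))" by auto
  define d where "d = R / (2 * real CARD('n))"
  have R: "R > 0"
  proof (rule ccontr)
    assume "\<not> R > 0"
    then have "R / (2 * real CARD('n)) \<le> 0" by (simp add: divide_nonpos_pos)
    with t show False by simp
  qed
  have B: "x \<in> ball c R" if "\<And>i. \<bar>x $ i - c $ i\<bar> \<le> d" for x
  proof -
    have "norm (x - c) \<le> (\<Sum>i\<in>UNIV. \<bar>(x - c) $ i\<bar>)" by (rule norm_le_l1_cart)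
    also have "\<dots> \<le> (\<Sum>i\<in>(UNIV :: 'n set). d)" using that by (intro sum_mono) simp
    also have "\<dots> = R / 2" by (simp add: d_def)
    finally show ?thesis using R by (simp add: dist_norm norm_minus_commute)
  qed
  have *: "v (c + t *\<^sub>R axis k 1) - v (c - t *\<^sub>R axis k 1) \<le> 2 * real CARD('n) * M * t / d"
    if "harmonic_on (ball c R) v" "\<And>x. \<bar>v x\<bar> = \<bar>u x\<bar>" for v
    by (rule harmonic_axis_difference_le[OF open_ball that(1) t(1)]) (use t B M that in \<open>auto simp: d_def\<close>)
  have eq: "2 * real CARD('n) * M * t / d = 4 * (real CARD('n))\<^sup>2 * M * t / R"
    using R by (simp add: d_def power2_eq_square)
  show ?thesis
    using *[OF u] *[OF harmonic_on_cmult[OF open_ball u, of "-1"]] unfolding eq by (auto simp: abs_le_iff)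
qed (use M in simp)

text \<open>The symmetric quotient \<open>h t / t\<close> tends to twice the partial derivative, so
  the bound is half of the constant in \<open>harmonic_axis_difference\<close>.\<close>

lemma harmonic_partial_bound:
  fixes u :: "real ^ 'n \<Rightarrow> real"
  assumes R: "R > 0" and u: "harmonic_on (ball c R) u" and M: "\<And>x. x \<in> ball c R \<Longrightarrow> \<bar>u x\<bar> \<le> M"
  shows "\<bar>partial k u c\<bar> \<le> 2 * (real CARD('n))\<^sup>2 * M / R"
proof -
  define h where "h = (\<lambda>t. u (c + t *\<^sub>R axis k 1) - u (c - t *\<^sub>R axis k 1))"
  let ?D = "partial k u c"
  have "has_partial k u c ?D"
    using u R C2_with_partials unfolding harmonic_on_def C2_with_def by (metis centre_in_ball)
  then have p: "((\<lambda>t. u (c + t *\<^sub>R axis k 1)) has_real_derivative ?D) (at 0)"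
    by (simp add: has_partial_def)
  have "((\<lambda>t. u (c + (-t) *\<^sub>R axis k 1)) has_real_derivative ?D * (-1)) (at 0)"
    by (rule DERIV_chain2[where f = "\<lambda>t. u (c + t *\<^sub>R axis k 1)"]) (use p in \<open>auto intro!: derivative_eq_intros\<close>)
  with p have "(h has_real_derivative ?D - ?D * (-1)) (at 0)"
    unfolding h_def by (intro DERIV_diff) auto
  then have "((\<lambda>t. (h t - h 0) / (t - 0)) \<longlongrightarrow> 2 * ?D) (at 0)"
    by (simp add: has_field_derivative_iff)
  then have "((\<lambda>t. h t / t) \<longlongrightarrow> 2 * ?D) (at 0)" by (simp add: h_def)
  then have "((\<lambda>t. \<bar>h t / t\<bar>) \<longlongrightarrow> \<bar>2 * ?D\<bar>) (at_right 0)"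
    by (intro tendsto_rabs) (auto intro: tendsto_mono at_le)
  moreover have "eventually (\<lambda>t. \<bar>h t / t\<bar> \<le> 4 * (real CARD('n))\<^sup>2 * M / R) (at_right 0)"
  proof -
    have "R / (2 * real CARD('n)) > 0" using R by simp
    then have "eventually (\<lambda>t. t \<in> {0<..<R / (2 * real CARD('n))}) (at_right 0)"
      by (rule eventually_at_right_real)
    then show ?thesis
    proof eventually_elim
      case (elim t)
      then have "\<bar>h t\<bar> \<le> 4 * (real CARD('n))\<^sup>2 * M / R * t"
        using harmonic_axis_difference[OF u M, of t k] by (simp add: h_def)
      then show ?case using elim by (simp add: abs_divide pos_divide_le_eq)
    qed
  qed
  ultimately have "\<bar>2 * ?D\<bar> \<le> 4 * (real CARD('n))\<^sup>2 * M / R"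
    by (rule tendsto_upperbound) simp
  then show ?thesis by (simp add: abs_mult)
qed

text \<open>Goes from \<open>x\<close> to \<open>y\<close> by replacing one coordinate at a time,
  since the estimate at hand is along an axis; the intermediate points mix coordinates of
  \<open>x\<close> and \<open>y\<close>.\<close>

lemma difference_le_axis_steps:
  fixes f :: "real ^ 'n \<Rightarrow> real"
  assumes step: "\<And>z k. (\<And>i. z $ i = x $ i \<or> z $ i = y $ i) \<Longrightarrow> z $ k = x $ k \<Longrightarrow>
      \<bar>f (z + (y $ k - x $ k) *\<^sub>R axis k 1) - f z\<bar> \<le> K * \<bar>y $ k - x $ k\<bar>"
  shows "\<bar>f y - f x\<bar> \<le> K * (\<Sum>i\<in>UNIV. \<bar>y $ i - x $ i\<bar>)"
proof -
  define z where "z = (\<lambda>A. \<chi> i. if i \<in> A then y $ i else x $ i)"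
  have "\<bar>f (z A) - f x\<bar> \<le> K * (\<Sum>i\<in>A. \<bar>y $ i - x $ i\<bar>)" if "finite A" for A
    using that
  proof (induction A rule: finite_induct)
    case empty
    have "z {} = x" by (simp add: z_def vec_eq_iff)
    then show ?case by simp
  next
    case (insert k A)
    have "z (insert k A) = z A + (y $ k - x $ k) *\<^sub>R axis k 1"
      using insert(2) by (auto simp: z_def vec_eq_iff axis_def)
    moreover have "\<bar>f (z A + (y $ k - x $ k) *\<^sub>R axis k 1) - f (z A)\<bar> \<le> K * \<bar>y $ k - x $ k\<bar>"
      using insert(2) by (intro step) (auto simp: z_def)
    ultimately show ?case using insert by (simp add: distrib_left)
  qed
  from this[of UNIV] show ?thesis by (simp add: z_def)
qed

lemma harmonic_lipschitz:
  fixes u :: "real ^ 'n \<Rightarrow> real"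
  assumes R: "R > 0" and u: "harmonic_on (ball p R) u" and M: "\<And>x. x \<in> ball p R \<Longrightarrow> \<bar>u x\<bar> \<le> M"
    and x: "x \<in> ball p (R / (4 * real CARD('n)))" and y: "y \<in> ball p (R / (4 * real CARD('n)))"
  shows "\<bar>u y - u x\<bar> \<le> 4 * (real CARD('n))^3 * M / R * norm (y - x)"
proof -
  define n where "n = real CARD('n)"
  have n: "n \<ge> 1" by (simp add: n_def Suc_leI)
  have M0: "M \<ge> 0" using M[of p] R by force
  have xy: "\<bar>x $ i - p $ i\<bar> < R / (4 * n)" "\<bar>y $ i - p $ i\<bar> < R / (4 * n)" for i
    using x y component_le_norm_cart[of "x - p" i] component_le_norm_cart[of "y - p" i]
    by (auto simp: dist_norm norm_minus_commute n_def)
  have "\<bar>u y - u x\<bar> \<le> (4 * n\<^sup>2 * M / R) * (\<Sum>i\<in>UNIV. \<bar>y $ i - x $ i\<bar>)"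
  proof (rule difference_le_axis_steps)
    fix z :: "real ^ 'n" and k
    assume z: "\<And>i. z $ i = x $ i \<or> z $ i = y $ i" "z $ k = x $ k"
    \<comment> \<open>The estimate compares points symmetric about a centre: \<open>m\<close> is the
      midpoint of the step and \<open>t\<close> half of its length.\<close>
    define m where "m = z + ((y $ k - x $ k) / 2) *\<^sub>R axis k 1"
    define t where "t = \<bar>y $ k - x $ k\<bar> / 2"
    have m: "\<bar>m $ i - p $ i\<bar> \<le> R / (4 * n)" for i
    proof (cases "i = k")
      case True
      then have e: "m $ i - p $ i = ((x $ k - p $ k) + (y $ k - p $ k)) / 2"
        using z(2) by (simp add: m_def axis_def field_simps)
      have "\<bar>(x $ k - p $ k) + (y $ k - p $ k)\<bar> \<le> 2 * (R / (4 * n))"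
        using abs_triangle_ineq[of "x $ k - p $ k" "y $ k - p $ k"] xy(1)[of k] xy(2)[of k] by linarith
      then show ?thesis unfolding e abs_divide by simp
    next
      case False
      then have "m $ i = z $ i" by (simp add: m_def axis_def)
      then show ?thesis using z(1)[of i] xy[of i] by auto
    qed
    have "norm (m - p) \<le> (\<Sum>i\<in>UNIV. \<bar>(m - p) $ i\<bar>)" by (rule norm_le_l1_cart)
    also have "\<dots> \<le> (\<Sum>i\<in>(UNIV :: 'n set). R / (4 * n))" using m by (intro sum_mono) simp
    also have "\<dots> = R / 4" using n by (simp add: n_def)
    finally have mp: "norm (m - p) \<le> R / 4" .
    \<comment> \<open>The radius \<open>R / (4 * n)\<close> is made for this: it keeps
      \<open>m\<close> within \<open>R / 4\<close> of \<open>p\<close>, and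
      \<open>t < R / (4 * n)\<close> is what the estimate on a ball of radius \<open>R / 2\<close>
      demands.\<close>
    have sub: "ball m (R / 2) \<subseteq> ball p R"
    proof
      fix q assume "q \<in> ball m (R / 2)"
      then show "q \<in> ball p R"
        using mp R dist_triangle[of p q m] by (simp add: dist_norm norm_minus_commute)
    qed
    have "t < R / (4 * n)"
      using xy[of k] by (auto simp: t_def abs_less_iff)
    then have "\<bar>u (m + t *\<^sub>R axis k 1) - u (m - t *\<^sub>R axis k 1)\<bar> \<le> 4 * n\<^sup>2 * M * t / (R / 2)"
      unfolding n_def using sub M
      by (intro harmonic_axis_difference harmonic_on_subset[OF u]) (auto simp: t_def)
    moreover have "\<bar>u (m + t *\<^sub>R axis k 1) - u (m - t *\<^sub>R axis k 1)\<bar>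
        = \<bar>u (z + (y $ k - x $ k) *\<^sub>R axis k 1) - u z\<bar>"
    proof (cases "y $ k \<ge> x $ k")
      case True
      then have "m + t *\<^sub>R axis k 1 = z + (y $ k - x $ k) *\<^sub>R axis k 1" "m - t *\<^sub>R axis k 1 = z"
        by (auto simp: m_def t_def vec_eq_iff axis_def)
      then show ?thesis by simp
    next
      case False
      then have "m - t *\<^sub>R axis k 1 = z + (y $ k - x $ k) *\<^sub>R axis k 1" "m + t *\<^sub>R axis k 1 = z"
        by (auto simp: m_def t_def vec_eq_iff axis_def field_simps)
      then show ?thesis by (simp add: abs_minus_commute)
    qed
    moreover have "4 * n\<^sup>2 * M * t / (R / 2) = 4 * n\<^sup>2 * M / R * \<bar>y $ k - x $ k\<bar>"
      by (simp add: t_def)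
    ultimately show "\<bar>u (z + (y $ k - x $ k) *\<^sub>R axis k 1) - u z\<bar> \<le> 4 * n\<^sup>2 * M / R * \<bar>y $ k - x $ k\<bar>"
      by linarith
  qed
  \<comment> \<open>Passing from the l1 norm to the Euclidean norm costs the third factor
    \<open>n\<close>.\<close>
  also have "\<dots> \<le> (4 * n\<^sup>2 * M / R) * (n * norm (y - x))"
  proof (rule mult_left_mono)
    have "(\<Sum>i\<in>UNIV. \<bar>y $ i - x $ i\<bar>) \<le> (\<Sum>i\<in>(UNIV :: 'n set). norm (y - x))"
      using component_le_norm_cart[of "y - x"] by (intro sum_mono) simp
    then show "(\<Sum>i\<in>UNIV. \<bar>y $ i - x $ i\<bar>) \<le> n * norm (y - x)" by (simp add: n_def)
    show "0 \<le> 4 * n\<^sup>2 * M / R" using M0 R by simp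
  qed
  also have "\<dots> = 4 * n ^ 3 * M / R * norm (y - x)"
    by (simp add: power2_eq_square power3_eq_cube)
  finally show ?thesis by (simp add: n_def)
qed

section \<open>Uniform limits of harmonic polynomials\<close>

lemma uniform_limit_equi_lipschitz:
  fixes f :: "nat \<Rightarrow> 'a :: metric_space \<Rightarrow> real"
  assumes "compact S" "L \<ge> 0"
    and lip: "\<And>m x y. x \<in> S \<Longrightarrow> y \<in> S \<Longrightarrow> \<bar>f m x - f m y\<bar> \<le> L * dist x y"
    and lim: "\<And>x. x \<in> S \<Longrightarrow> (\<lambda>m. f m x) \<longlonglongrightarrow> u x"
  shows "uniform_limit S f u sequentially"
  unfolding uniform_limit_iff
proof (intro allI impI)
  fix e :: real assume e: "e > 0"
  \<comment> \<open>Two errors of at most \<open>L * \<delta> \<le> e / 4\<close>, one for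
    \<open>f m\<close> and one for \<open>u\<close>, and \<open>e / 4\<close> at a point of a finite
    net add up to less than \<open>e\<close>; \<open>L + 1\<close> covers
    \<open>L = 0\<close>.\<close>
  define \<delta> where "\<delta> = e / (4 * (L + 1))"
  have \<delta>: "\<delta> > 0" "L * \<delta> \<le> e / 4"
    using e assms(2) by (auto simp: \<delta>_def field_simps)
  have ulip: "\<bar>u x - u y\<bar> \<le> L * dist x y" if "x \<in> S" "y \<in> S" for x y
  proof (rule tendsto_upperbound)
    show "(\<lambda>m. \<bar>f m x - f m y\<bar>) \<longlonglongrightarrow> \<bar>u x - u y\<bar>" using lim that by (intro tendsto_intros) auto
  qed (use lip that in auto)
  obtain K where K: "finite K" "K \<subseteq> S" "S \<subseteq> (\<Union>x\<in>K. ball x \<delta>)"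
    using seq_compact_imp_totally_bounded[OF compact_imp_seq_compact[OF assms(1)]] \<delta>(1) by meson
  have "\<forall>\<^sub>F m in sequentially. \<forall>x\<in>K. dist (f m x) (u x) < e / 4"
  proof (intro eventually_ball_finite K(1) ballI)
    fix x assume "x \<in> K"
    with K(2) lim have "(\<lambda>m. f m x) \<longlonglongrightarrow> u x" by blast
    then show "\<forall>\<^sub>F m in sequentially. dist (f m x) (u x) < e / 4"
      by (rule tendstoD) (use e in simp)
  qed
  then show "\<forall>\<^sub>F m in sequentially. \<forall>x\<in>S. dist (f m x) (u x) < e"
  proof eventually_elim
    case (elim m)
    show ?case
    proof
      fix x assume "x \<in> S"
      with K obtain z where z: "z \<in> K" "dist z x < \<delta>" by auto
      have zS: "z \<in> S" using z K by blast
      have Lz: "L * dist z x \<le> e / 4"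
        using mult_left_mono[of "dist z x" \<delta> L] z(2) assms(2) \<delta>(2) by simp
      show "dist (f m x) (u x) < e"
      proof -
        have "\<bar>f m z - u z\<bar> < e / 4" using elim z(1) by (auto simp: dist_real_def)
        with lip[OF zS \<open>x \<in> S\<close>, of m] ulip[OF zS \<open>x \<in> S\<close>] Lz e show ?thesis
          unfolding dist_real_def by linarith
      qed
    qed
  qed
qed

text \<open>Termwise differentiation under uniform convergence of the derivatives, carried out on an
  axis segment. Here \<open>f'\<close> and \<open>g'\<close> denote the limits of \<open>f\<close>
  and \<open>g\<close>, not derivatives.\<close>

lemma has_partial_limit:
  fixes f :: "nat \<Rightarrow> real ^ 'n \<Rightarrow> real"
  assumes "open S" "x \<in> S"
    and f: "\<And>m y. y \<in> S \<Longrightarrow> has_partial i (f m) y (g m y)"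
    and g: "uniform_limit S g g' sequentially"
    and lim: "\<And>y. y \<in> S \<Longrightarrow> (\<lambda>m. f m y) \<longlonglongrightarrow> f' y"
  shows "has_partial i f' x (g' x)"
proof -
  let ?l = "\<lambda>t. x + t *\<^sub>R axis i 1"
  obtain \<delta> where \<delta>: "\<delta> > 0" "ball x \<delta> \<subseteq> S" using assms(1,2) openE by blast
  define J where "J = {-\<delta><..<\<delta>}"
  have l: "?l t \<in> S" if "t \<in> J" for t
    using \<delta>(2) that by (auto simp: dist_norm subset_iff J_def)
  have J: "0 \<in> J" "open J" "convex J" using \<delta> by (auto simp: J_def)
  have "\<exists>G. \<forall>t\<in>J. (\<lambda>m. f m (?l t)) \<longlonglongrightarrow> G t \<and> (G has_derivative (\<lambda>h. g' (?l t) * h)) (at t within J)"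
  proof (rule has_derivative_sequence[OF J(3) _ _ J(1)])
    show "((\<lambda>t. f m (?l t)) has_derivative (\<lambda>h. g m (?l t) * h)) (at t within J)" if "t \<in> J" for m t
      using has_partial_shift[OF f[OF l[OF that]]]
      by (auto simp: has_field_derivative_def intro: has_derivative_at_withinI)
    show "(\<lambda>m. f m (?l 0)) \<longlonglongrightarrow> f' (?l 0)" using lim l[OF J(1)] by blast
    show "\<forall>\<^sub>F m in sequentially. \<forall>t\<in>J. \<forall>h. norm (g m (?l t) * h - g' (?l t) * h) \<le> e * norm h"
      if "e > 0" for e
    proof -
      have "\<forall>\<^sub>F m in sequentially. \<forall>y\<in>S. dist (g m y) (g' y) < e"
        using g that by (simp add: uniform_limit_iff)
      then show ?thesis
      proof eventually_elim
        case (elim m)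
        show ?case
        proof (intro ballI allI)
          fix t h assume "t \<in> J"
          then have "\<bar>g m (?l t) - g' (?l t)\<bar> \<le> e" using elim l by (force simp: dist_real_def)
          then have "\<bar>g m (?l t) - g' (?l t)\<bar> * \<bar>h\<bar> \<le> e * \<bar>h\<bar>" by (rule mult_right_mono) simp
          then show "norm (g m (?l t) * h - g' (?l t) * h) \<le> e * norm h"
            by (simp add: abs_mult left_diff_distrib[symmetric])
        qed
      qed
    qed
  qed
  then obtain G where G: "\<And>t. t \<in> J \<Longrightarrow> (\<lambda>m. f m (?l t)) \<longlonglongrightarrow> G t"
    "(G has_derivative (\<lambda>h. g' (?l 0) * h)) (at 0 within J)" using J(1) by blast
  have "(G has_real_derivative g' x) (at 0)"
    using G(2) unfolding has_field_derivative_def at_within_open[OF J(1,2)] by simp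
  moreover have "G t = f' (?l t)" if "t \<in> J" for t
    using G(1)[OF that] lim[OF l[OF that]] LIMSEQ_unique by blast
  ultimately show ?thesis
    unfolding has_partial_def
    by (rule has_field_derivative_transform_within_open[OF _ J(2,1)])
qed

text \<open>Every point of the smaller ball is the centre of a ball of radius \<open>r - r'\<close>
  inside the larger one, where \<open>harmonic_partial_bound\<close> applies to
  \<open>q m - q l\<close>.\<close>

lemma uniformly_Cauchy_partial:
  fixes q :: "nat \<Rightarrow> real ^ 'n \<Rightarrow> real"
  assumes q: "\<And>m. real_polynomial_function (q m)" "\<And>m. harmonic_on UNIV (q m)"
    and C: "uniformly_Cauchy_on (cball c r) q" and "r' < r"
  shows "uniformly_Cauchy_on (cball c r') (\<lambda>m. partial i (q m))"
proof (rule uniformly_Cauchy_onI)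
  fix e :: real assume e: "e > 0"
  define R where "R = r - r'"
  define n where "n = real CARD('n)"
  have n: "n \<ge> 1" by (simp add: n_def Suc_leI)
  have R: "R > 0" using assms by (simp add: R_def)
  \<comment> \<open>Makes the bound \<open>2 * n\<^sup>2 * e' / R\<close> equal to
    \<open>e / 2\<close>.\<close>
  define e' where "e' = e * R / (4 * n\<^sup>2)"
  have e': "e' > 0" using e R n by (simp add: e'_def)
  obtain N where N: "\<And>x m l. x \<in> cball c r \<Longrightarrow> m \<ge> N \<Longrightarrow> l \<ge> N \<Longrightarrow> dist (q m x) (q l x) < e'"
    using C e' unfolding uniformly_Cauchy_on_def by meson
  have "dist (partial i (q m) x) (partial i (q l) x) < e"
    if "x \<in> cball c r'" "m \<ge> N" "l \<ge> N" for x m l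
  proof -
    have sub: "y \<in> cball c r" if "y \<in> ball x R" for y
      using that \<open>x \<in> cball c r'\<close> dist_triangle[of c y x] by (simp add: R_def)
    have "\<bar>partial i (\<lambda>x. q m x - q l x) x\<bar> \<le> 2 * n\<^sup>2 * e' / R"
      unfolding n_def
    proof (rule harmonic_partial_bound[OF R])
      show "harmonic_on (ball x R) (\<lambda>x. q m x - q l x)"
        by (rule harmonic_on_subset[OF harmonic_on_diff[OF open_UNIV q(2) q(2)]]) auto
      show "\<bar>q m y - q l y\<bar> \<le> e'" if "y \<in> ball x R" for y
        using N[OF sub[OF that], of m l] \<open>m \<ge> N\<close> \<open>l \<ge> N\<close> by (simp add: dist_real_def)
    qed
    also have "\<dots> < e" using e R n by (simp add: e'_def)
    finally show ?thesis
      using has_partial_imp_partial[OF has_partial_diff[OF polynomial_has_partial(1) polynomial_has_partial(1)], OF q(1) q(1)]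
      by (simp add: dist_real_def)
  qed
  then show "\<exists>N. \<forall>x\<in>cball c r'. \<forall>m\<ge>N. \<forall>l\<ge>N. dist (partial i (q m) x) (partial i (q l) x) < e" by blast
qed

lemma harmonic_polynomials_limit:
  fixes q :: "nat \<Rightarrow> real ^ 'n \<Rightarrow> real"
  assumes q: "\<And>m. real_polynomial_function (q m)" "\<And>m. harmonic_on UNIV (q m)"
    and C: "uniformly_Cauchy_on (cball c r) q"
  shows "harmonic_on (ball c r) (\<lambda>x. lim (\<lambda>m. q m x))"
proof (rule harmonic_on_local)
  fix x assume x: "x \<in> ball c r"
  \<comment> \<open>Two derivatives cost radius twice: first derivatives converge uniformly on
    radius \<open>s' < r\<close>, second ones on radius \<open>s < s'\<close>.\<close>
  define s where "s = (dist c x + r) / 2"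
  define s' where "s' = (s + r) / 2"
  have s: "dist c x < s" "s < s'" "s' < r" using x by (auto simp: s_def s'_def)
  define d where "d = (\<lambda>i x. lim (\<lambda>m. partial i (q m) x))"
  define dd where "dd = (\<lambda>i j x. lim (\<lambda>m. partial j (partial i (q m)) x))"
  let ?v = "\<lambda>x. lim (\<lambda>m. q m x)"
  have Cd: "uniformly_Cauchy_on (cball c s') (\<lambda>m. partial i (q m))" for i
    using uniformly_Cauchy_partial[OF q C s(3)] .
  have Cdd: "uniformly_Cauchy_on (cball c s) (\<lambda>m. partial j (partial i (q m)))" for i j
    using q by (intro uniformly_Cauchy_partial[OF _ _ Cd s(2)] polynomial_has_partial harmonic_partial)
  have UL: "uniform_limit (ball c s) f (\<lambda>x. lim (\<lambda>m. f m x)) sequentially"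
    if "uniformly_Cauchy_on (cball c \<rho>) f" "s \<le> \<rho>" for f :: "nat \<Rightarrow> real ^ 'n \<Rightarrow> real" and \<rho>
  proof (rule uniform_limit_on_subset)
    show "uniform_limit (cball c \<rho>) f (\<lambda>x. lim (\<lambda>m. f m x)) sequentially"
      using Cauchy_uniformly_convergent[OF that(1)] uniformly_convergent_uniform_limit_iff by blast
  qed (use that in auto)
  have v: "uniform_limit (ball c s) q ?v sequentially" using UL[OF C] s by simp
  have d: "uniform_limit (ball c s) (\<lambda>m. partial i (q m)) (d i) sequentially" for i
    unfolding d_def using UL[OF Cd] s by simp
  have dd: "uniform_limit (ball c s) (\<lambda>m. partial j (partial i (q m))) (dd i j) sequentially" for i j
    unfolding dd_def using UL[OF Cdd] by simp
  have cont: "continuous_on (ball c s) g"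
    if "uniform_limit (ball c s) f g sequentially" "\<And>m. real_polynomial_function (f m)"
    for f :: "nat \<Rightarrow> real ^ 'n \<Rightarrow> real" and g
    using that by (intro uniform_limit_theorem[OF _ that(1)] always_eventually)
      (auto intro: C2_continuous polynomial_C2)
  have *: "C2_with (ball c s) ?v d dd"
    unfolding C2_with_def
  proof (intro conjI allI ballI)
    fix i j
    show "continuous_on (ball c s) ?v" by (rule cont[OF v q(1)])
    show "continuous_on (ball c s) (d i)" by (rule cont[OF d polynomial_has_partial(2)[OF q(1)]])
    show "continuous_on (ball c s) (dd i j)"
      by (rule cont[OF dd polynomial_has_partial(2)[OF polynomial_has_partial(2)[OF q(1)]]])
    fix y assume y: "y \<in> ball c s"
    show "has_partial i ?v y (d i y)"
      by (rule has_partial_limit[OF open_ball y polynomial_has_partial(1)[OF q(1)] d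
            tendsto_uniform_limitI[OF v]])
    show "has_partial j (d i) y (dd i j y)"
      by (rule has_partial_limit[OF open_ball y
            polynomial_has_partial(1)[OF polynomial_has_partial(2)[OF q(1)]] dd
            tendsto_uniform_limitI[OF d]])
  qed
  have "(\<Sum>i\<in>UNIV. dd i i y) = 0" if "y \<in> ball c s" for y
  proof -
    have "(\<lambda>m. \<Sum>i\<in>UNIV. partial i (partial i (q m)) y) \<longlonglongrightarrow> (\<Sum>i\<in>UNIV. dd i i y)"
      using that by (intro tendsto_sum tendsto_uniform_limitI[OF dd])
    moreover have "(\<Sum>i\<in>UNIV. partial i (partial i (q m)) y) = 0" for m
      using q(2)[of m] by (simp add: harmonic_on_def laplacian_def)
    ultimately show ?thesis by (simp add: LIMSEQ_const_iff)
  qed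
  then have "harmonic_on (ball c s) ?v"
    using C2_withD(1,2)[OF open_ball *] by (simp add: harmonic_on_def)
  then show "\<exists>T. open T \<and> x \<in> T \<and> harmonic_on T ?v"
    using s by (intro exI[of _ "ball c s"]) auto
qed

lemma polynomial_uniform_approximation:
  fixes f :: "'a :: euclidean_space \<Rightarrow> real"
  assumes "compact K" "continuous_on K f"
  obtains p where "\<And>m. real_polynomial_function (p m)" "uniform_limit K p f sequentially"
proof -
  have "\<exists>p. real_polynomial_function p \<and> (\<forall>x\<in>K. \<bar>f x - p x\<bar> < inverse (real (Suc m)))" for m
    by (rule Stone_Weierstrass_real_polynomial_function[OF assms, of "inverse (real (Suc m))"]) auto
  then obtain p where p: "\<And>m. real_polynomial_function (p m)"
    "\<And>m x. x \<in> K \<Longrightarrow> \<bar>f x - p m x\<bar> < inverse (real (Suc m))" by metis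
  have "uniform_limit K p f sequentially"
    unfolding uniform_limit_sequentially_iff
  proof (intro allI impI)
    fix e :: real assume "e > 0"
    then obtain N where N: "inverse (real (Suc N)) < e" using reals_Archimedean by blast
    have "dist (p m x) (f x) < e" if "m \<ge> N" "x \<in> K" for m x
    proof -
      have "inverse (real (Suc m)) \<le> inverse (real (Suc N))" using that by (intro le_imp_inverse_le) auto
      with p(2)[OF that(2), of m] N show ?thesis unfolding dist_real_def by linarith
    qed
    then show "\<exists>N. \<forall>m\<ge>N. \<forall>x\<in>K. dist (p m x) (f x) < e" by blast
  qed
  with p(1) show ?thesis by (rule that)
qed

section \<open>The Dirichlet problem on balls and limits of harmonic functions\<close>

lemma harmonic_uniformly_Cauchy:
  fixes q :: "nat \<Rightarrow> real ^ 'n \<Rightarrow> real"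
  assumes V: "open V" "bounded V"
    and q: "\<And>m. continuous_on (closure V) (q m)" "\<And>m. harmonic_on V (q m)"
    and C: "uniformly_Cauchy_on (frontier V) q"
  shows "uniformly_Cauchy_on (closure V) q"
proof (rule uniformly_Cauchy_onI)
  fix e :: real assume e: "e > 0"
  obtain N where N: "\<And>x m l. x \<in> frontier V \<Longrightarrow> m \<ge> N \<Longrightarrow> l \<ge> N \<Longrightarrow> dist (q m x) (q l x) < e / 2"
    using C[unfolded uniformly_Cauchy_on_def, rule_format, of "e / 2"] e by auto
  have "dist (q m x) (q l x) < e" if x: "x \<in> closure V" and ml: "m \<ge> N" "l \<ge> N" for x m l
  proof -
    have "\<bar>q m x - q l x\<bar> \<le> e / 2"
    proof (rule harmonic_bound[OF V])
      show "continuous_on (closure V) (\<lambda>x. q m x - q l x)" by (intro continuous_intros q)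
      show "harmonic_on V (\<lambda>x. q m x - q l x)" by (intro harmonic_on_diff q V)
      show "\<bar>q m y - q l y\<bar> \<le> e / 2" if "y \<in> frontier V" for y
        using N[OF that ml] by (simp add: dist_real_def)
    qed (rule x)
    then show ?thesis using e by (simp add: dist_real_def)
  qed
  then show "\<exists>N. \<forall>x\<in>closure V. \<forall>m\<ge>N. \<forall>l\<ge>N. dist (q m x) (q l x) < e" by blast
qed

text \<open>The common part of the ball and of the general domain. Harmonicity of the limit is left
  out because the two cases obtain it differently: from polynomials on the ball, from small balls on
  a domain.\<close>

lemma dirichlet_approximation:
  fixes q :: "nat \<Rightarrow> real ^ 'n \<Rightarrow> real"
  assumes V: "open V" "bounded V"
    and q: "\<And>m. continuous_on (closure V) (q m)" "\<And>m. harmonic_on V (q m)"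
    and ul: "uniform_limit (frontier V) q f sequentially"
  shows "uniformly_Cauchy_on (closure V) q"
    and "uniform_limit (closure V) q (\<lambda>x. lim (\<lambda>m. q m x)) sequentially"
    and "continuous_on (closure V) (\<lambda>x. lim (\<lambda>m. q m x))"
    and "x \<in> frontier V \<Longrightarrow> lim (\<lambda>m. q m x) = f x"
proof -
  have "uniformly_Cauchy_on (frontier V) q"
    using ul uniformly_convergent_Cauchy uniformly_convergent_on_def by blast
  then show C: "uniformly_Cauchy_on (closure V) q" by (rule harmonic_uniformly_Cauchy[OF V q])
  show L: "uniform_limit (closure V) q (\<lambda>x. lim (\<lambda>m. q m x)) sequentially"
    using Cauchy_uniformly_convergent[OF C] uniformly_convergent_uniform_limit_iff by blast
  show "continuous_on (closure V) (\<lambda>x. lim (\<lambda>m. q m x))"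
    using q by (intro uniform_limit_theorem[OF _ L]) auto
  show "x \<in> frontier V \<Longrightarrow> lim (\<lambda>m. q m x) = f x"
    using tendsto_uniform_limitI[OF ul] by (intro limI)
qed

theorem dirichlet_problem_ball:
  fixes f :: "real ^ 'n \<Rightarrow> real"
  assumes r: "r > 0" and f: "continuous_on (sphere c r) f"
  shows "\<exists>v. continuous_on (cball c r) v \<and> harmonic_on (ball c r) v \<and> (\<forall>x\<in>sphere c r. v x = f x)"
proof -
  obtain p where p: "\<And>m. real_polynomial_function (p m)" "uniform_limit (sphere c r) p f sequentially"
    using polynomial_uniform_approximation[OF compact_sphere f] by metis
  obtain q where q: "\<And>m. real_polynomial_function (q m)" "\<And>m. harmonic_on UNIV (q m)"
    "\<And>m x. x \<in> sphere c r \<Longrightarrow> q m x = p m x"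
    using harmonic_polynomial_on_ball[OF p(1) r, of c] by metis
  have ul: "uniform_limit (frontier (ball c r)) q f sequentially"
    using p(2) r q(3) by (simp add: uniform_limit_iff)
  have 1: "continuous_on (closure (ball c r)) (q m)" for m
    using q(1) by (intro C2_continuous polynomial_C2)
  have 2: "harmonic_on (ball c r) (q m)" for m using harmonic_on_subset[OF q(2)] by blast
  note A = dirichlet_approximation[OF open_ball bounded_ball 1 2 ul]
  have "uniformly_Cauchy_on (cball c r) q" using A(1) r by simp
  with A(3,4) r show ?thesis
    by (intro exI[of _ "\<lambda>x. lim (\<lambda>m. q m x)"]) (auto intro: harmonic_polynomials_limit q)
qed

text \<open>The limit is compared with the Dirichlet solution \<open>v\<close> that has the values
  of \<open>u\<close> on the sphere: by \<open>harmonic_bound\<close> the \<open>f m\<close>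
  converge to \<open>v\<close> as well, so \<open>u = v\<close>. This removes the restriction to
  polynomials.\<close>

lemma harmonic_uniform_limit:
  fixes f :: "nat \<Rightarrow> real ^ 'n \<Rightarrow> real"
  assumes r: "r > 0" and f: "\<And>m. continuous_on (cball c r) (f m)" "\<And>m. harmonic_on (ball c r) (f m)"
    and ul: "uniform_limit (cball c r) f u sequentially"
  shows "harmonic_on (ball c r) u"
proof -
  have cu: "continuous_on (cball c r) u"
    using f by (intro uniform_limit_theorem[OF _ ul]) auto
  then have "continuous_on (sphere c r) u" by (rule continuous_on_subset) auto
  then obtain v where v: "continuous_on (cball c r) v" "harmonic_on (ball c r) v"
    "\<And>x. x \<in> sphere c r \<Longrightarrow> v x = u x" using dirichlet_problem_ball[OF r] by blast
  have "v x = u x" if x: "x \<in> cball c r" for x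
  proof -
    have "(\<lambda>m. f m x) \<longlonglongrightarrow> v x"
    proof (rule LIMSEQ_I)
      fix e :: real assume e: "e > 0"
      then obtain N where N: "\<And>m y. m \<ge> N \<Longrightarrow> y \<in> cball c r \<Longrightarrow> dist (f m y) (u y) < e / 2"
        using ul unfolding uniform_limit_iff eventually_sequentially by (meson half_gt_zero)
      have "norm (f m x - v x) < e" if m: "m \<ge> N" for m
      proof -
        have "\<bar>f m x - v x\<bar> \<le> e / 2"
        proof (rule harmonic_bound[OF open_ball bounded_ball])
          show "continuous_on (closure (ball c r)) (\<lambda>x. f m x - v x)"
            using f(1)[of m] v(1) r by (intro continuous_intros) auto
          show "harmonic_on (ball c r) (\<lambda>x. f m x - v x)" by (intro harmonic_on_diff f v open_ball)
          show "x \<in> closure (ball c r)" using x r by simp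
          show "\<bar>f m y - v y\<bar> \<le> e / 2" if "y \<in> frontier (ball c r)" for y
            using that r N[OF m, of y] v(3)[of y] by (auto simp: dist_real_def)
        qed
        then show ?thesis using e by simp
      qed
      then show "\<exists>N. \<forall>m\<ge>N. norm (f m x - v x) < e" by blast
    qed
    moreover have "(\<lambda>m. f m x) \<longlonglongrightarrow> u x" by (rule tendsto_uniform_limitI[OF ul x])
    ultimately show ?thesis using LIMSEQ_unique by blast
  qed
  then show ?thesis by (intro harmonic_on_cong[OF open_ball v(2)]) auto
qed

text \<open>A uniform bound yields a uniform Lipschitz constant near each point, which turns
  pointwise into uniform convergence.\<close>

lemma harmonic_pointwise_limit:
  fixes f :: "nat \<Rightarrow> real ^ 'n \<Rightarrow> real"
  assumes "open S" and f: "\<And>m. harmonic_on S (f m)" and M: "\<And>m x. x \<in> S \<Longrightarrow> \<bar>f m x\<bar> \<le> M"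
    and lim: "\<And>x. x \<in> S \<Longrightarrow> (\<lambda>m. f m x) \<longlonglongrightarrow> u x"
  shows "harmonic_on S u"
proof (rule harmonic_on_local)
  fix p assume p: "p \<in> S"
  then obtain R where R: "R > 0" "ball p R \<subseteq> S" using assms(1) openE by blast
  \<comment> \<open>Half the radius on which \<open>harmonic_lipschitz\<close> applies, so that the
    closed ball fits.\<close>
  define \<rho> where "\<rho> = R / (8 * real CARD('n))"
  have n: "real CARD('n) \<ge> 1" by (simp add: Suc_leI)
  have \<rho>: "\<rho> > 0" "\<rho> < R / (4 * real CARD('n))" using R by (auto simp: \<rho>_def field_simps)
  have "1 \<le> 4 * real CARD('n)" using n by linarith
  then have "R / (4 * real CARD('n)) \<le> R / 1" using R by (intro divide_left_mono) auto
  with \<rho> R(2) have sub: "cball p \<rho> \<subseteq> S" by fastforce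
  have M0: "M \<ge> 0" using M[OF p, of 0] by linarith
  have "uniform_limit (cball p \<rho>) f u sequentially"
  proof (rule uniform_limit_equi_lipschitz[OF compact_cball])
    show "0 \<le> 4 * (real CARD('n))^3 * M / R" using M0 R by simp
    show "\<bar>f m x - f m y\<bar> \<le> 4 * (real CARD('n))^3 * M / R * dist x y"
      if "x \<in> cball p \<rho>" "y \<in> cball p \<rho>" for m x y
      unfolding dist_norm
    proof (rule harmonic_lipschitz[OF R(1) harmonic_on_subset[OF f R(2)]])
      show "\<bar>f m x\<bar> \<le> M" if "x \<in> ball p R" for x using M R(2) that by blast
    qed (use \<rho>(2) that in auto)
    show "(\<lambda>m. f m x) \<longlonglongrightarrow> u x" if "x \<in> cball p \<rho>" for x using that sub lim by blast
  qed
  moreover have *: "harmonic_on (ball p \<rho>) (f m)" for m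
    using harmonic_on_subset[OF f] sub ball_subset_cball by blast
  moreover have **: "continuous_on (cball p \<rho>) (f m)" for m
    using f[of m] sub by (meson C2_continuous continuous_on_subset harmonic_on_def)
  ultimately have "harmonic_on (ball p \<rho>) u" by (intro harmonic_uniform_limit[OF \<rho>(1) ** *])
  then show "\<exists>T. open T \<and> p \<in> T \<and> harmonic_on T u" using \<rho> by (intro exI[of _ "ball p \<rho>"]) auto
qed

section \<open>Sweeping and barriers\<close>

lemma frontier_of_open: "open V \<Longrightarrow> frontier V = closure V - V"
  by (simp add: frontier_def interior_open)

text \<open>Testing against supersolutions on arbitrary open subsets makes the notion stable under
  harmonic replacement without any local-to-global argument.\<close>

definition subsolution :: "(real ^ 'n) set \<Rightarrow> (real ^ 'n \<Rightarrow> real) \<Rightarrow> bool" where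
  "subsolution \<Omega> u \<longleftrightarrow> continuous_on (closure \<Omega>) u \<and>
     (\<forall>V h. open V \<and> V \<subseteq> \<Omega> \<and> continuous_on (closure V) h \<and> C_k_on 2 h V \<and>
        (\<forall>x\<in>V. laplacian h x \<le> 0) \<and> (\<forall>x\<in>frontier V. u x \<le> h x) \<longrightarrow> (\<forall>x\<in>V. u x \<le> h x))"

lemma subsolutionD:
  assumes "subsolution \<Omega> u" "open V" "V \<subseteq> \<Omega>" "continuous_on (closure V) h" "C_k_on 2 h V"
    "\<And>x. x \<in> V \<Longrightarrow> laplacian h x \<le> 0" "\<And>x. x \<in> frontier V \<Longrightarrow> u x \<le> h x" "x \<in> V"
  shows "u x \<le> h x"
  using assms unfolding subsolution_def by blast

lemma comparison_principle:
  fixes u h :: "real ^ 'n \<Rightarrow> real"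
  assumes V: "open V" "bounded V" and "continuous_on (closure V) u" "continuous_on (closure V) h"
    and C2: "C_k_on 2 u V" "C_k_on 2 h V"
    and lap: "\<And>x. x \<in> V \<Longrightarrow> laplacian h x \<le> laplacian u x"
    and bd: "\<And>x. x \<in> frontier V \<Longrightarrow> u x \<le> h x" and "x \<in> closure V"
  shows "u x \<le> h x"
proof -
  have "u x - h x \<le> 0"
  proof (rule maximum_principle[OF V])
    show "continuous_on (closure V) (\<lambda>x. u x - h x)" by (intro continuous_intros assms)
    show "C_k_on 2 (\<lambda>x. u x - h x) V" by (intro C2_diff C2 V)
    show "0 \<le> laplacian (\<lambda>x. u x - h x) x" if "x \<in> V" for x
      using lap[OF that] laplacian_diff[OF V(1) C2 that] by simp
    show "u x - h x \<le> 0" if "x \<in> frontier V" for x using bd[OF that] by simp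
  qed (rule assms(9))
  then show ?thesis by simp
qed

lemma subsolution_of_subharmonic:
  fixes p :: "real ^ 'n \<Rightarrow> real"
  assumes "bounded \<Omega>" "continuous_on (closure \<Omega>) p" "C_k_on 2 p \<Omega>"
    and "\<And>x. x \<in> \<Omega> \<Longrightarrow> 0 \<le> laplacian p x"
  shows "subsolution \<Omega> p"
  unfolding subsolution_def
proof (intro conjI allI impI ballI assms(2))
  fix V h x
  assume "open V \<and> V \<subseteq> \<Omega> \<and> continuous_on (closure V) h \<and> C_k_on 2 h V \<and>
    (\<forall>x\<in>V. laplacian h x \<le> 0) \<and> (\<forall>x\<in>frontier V. p x \<le> h x)" and x: "x \<in> V"
  then have V: "open V" "V \<subseteq> \<Omega>" "continuous_on (closure V) h" "C_k_on 2 h V"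
    "\<And>x. x \<in> V \<Longrightarrow> laplacian h x \<le> 0" "\<And>x. x \<in> frontier V \<Longrightarrow> p x \<le> h x" by auto
  show "p x \<le> h x"
  proof (rule comparison_principle[OF V(1) bounded_subset[OF assms(1) V(2)] _ V(3) _ V(4) _ V(6)])
    show "continuous_on (closure V) p"
      using continuous_on_subset[OF assms(2) closure_mono[OF V(2)]] .
    show "C_k_on 2 p V" by (rule C2_subset[OF assms(3) V(2)])
    show "laplacian h x \<le> laplacian p x" if "x \<in> V" for x
      using V(5)[OF that] assms(4)[of x] V(2) that by force
    show "x \<in> closure V" using x closure_subset by blast
  qed
qed

text \<open>A test set \<open>V\<close> may overlap the ball only partly, so the comparison goes in
  two stages: \<open>u \<le> v\<close> gives \<open>u \<le> h\<close> on \<open>V\<close>, and then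
  the harmonic part is compared with \<open>h\<close> on the intersection of \<open>V\<close> with
  the ball.\<close>

lemma subsolution_harmonic_replacement:
  fixes u :: "real ^ 'n \<Rightarrow> real"
  assumes \<Omega>: "open \<Omega>" "bounded \<Omega>" and u: "subsolution \<Omega> u" and r: "r > 0" and sub: "cball c r \<subseteq> \<Omega>"
  shows "\<exists>v. subsolution \<Omega> v \<and> (\<forall>x. u x \<le> v x) \<and> (\<forall>x. x \<notin> ball c r \<longrightarrow> v x = u x) \<and>
    harmonic_on (ball c r) v"
proof -
  have cu: "continuous_on (closure \<Omega>) u" using u by (simp add: subsolution_def)
  have sub': "cball c r \<subseteq> closure \<Omega>" using sub closure_subset by blast
  then have "continuous_on (sphere c r) u"
    by (intro continuous_on_subset[OF cu]) auto
  then obtain p where p: "continuous_on (cball c r) p" "harmonic_on (ball c r) p"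
    "\<And>x. x \<in> sphere c r \<Longrightarrow> p x = u x" using dirichlet_problem_ball[OF r] by blast
  define v where "v = (\<lambda>x. if x \<in> cball c r then p x else u x)"
  have vu: "v x = u x" if "x \<notin> ball c r" for x using that p(3)[of x] by (auto simp: v_def)
  have vp: "v x = p x" if "x \<in> cball c r" for x using that by (simp add: v_def)
  have up: "u x \<le> p x" if "x \<in> ball c r" for x
  proof (rule subsolutionD[OF u open_ball])
    show "ball c r \<subseteq> \<Omega>" using sub ball_subset_cball by blast
    show "continuous_on (closure (ball c r)) p" using p(1) r by simp
    show "C_k_on 2 p (ball c r)" "\<And>x. x \<in> ball c r \<Longrightarrow> laplacian p x \<le> 0"
      using p(2) by (auto simp: harmonic_on_def)
    show "u x \<le> p x" if "x \<in> frontier (ball c r)" for x using that r p(3)[of x] by simp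
  qed (rule that)
  have uv: "u x \<le> v x" for x using up[of x] vu[of x] vp[of x] by (cases "x \<in> ball c r") auto
  have cv: "continuous_on (closure \<Omega>) v"
  proof -
    have "continuous_on (cball c r \<union> (closure \<Omega> - ball c r)) v"
      unfolding v_def
    proof (rule continuous_on_cases)
      show "continuous_on (closure \<Omega> - ball c r) u" by (rule continuous_on_subset[OF cu]) auto
      show "closed (closure \<Omega> - ball c r)" by (intro closed_Diff) auto
      show "\<forall>x. x \<in> cball c r \<and> x \<notin> cball c r \<or> x \<in> closure \<Omega> - ball c r \<and> x \<in> cball c r \<longrightarrow> p x = u x"
        using p(3) by auto
    qed (use p(1) in auto)
    moreover have "cball c r \<union> (closure \<Omega> - ball c r) = closure \<Omega>" using sub' by auto
    ultimately show ?thesis by simp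
  qed
  have "subsolution \<Omega> v"
    unfolding subsolution_def
  proof (intro conjI allI impI ballI cv)
    fix V h x
    assume "open V \<and> V \<subseteq> \<Omega> \<and> continuous_on (closure V) h \<and> C_k_on 2 h V \<and>
      (\<forall>x\<in>V. laplacian h x \<le> 0) \<and> (\<forall>x\<in>frontier V. v x \<le> h x)" and x: "x \<in> V"
    then have V: "open V" "V \<subseteq> \<Omega>" "continuous_on (closure V) h" "C_k_on 2 h V"
      "\<And>x. x \<in> V \<Longrightarrow> laplacian h x \<le> 0" "\<And>x. x \<in> frontier V \<Longrightarrow> v x \<le> h x" by auto
    have uf: "u x \<le> h x" if "x \<in> frontier V" for x using V(6)[OF that] uv[of x] by simp
    have uh: "u x \<le> h x" if "x \<in> V" for x by (rule subsolutionD[OF u V(1-5) uf that])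
    show "v x \<le> h x"
    proof (cases "x \<in> ball c r")
      case False
      then show ?thesis using vu uh x by simp
    next
      case True
      let ?W = "V \<inter> ball c r"
      have W: "open ?W" "bounded ?W" "closure ?W \<subseteq> cball c r" "closure ?W \<subseteq> closure V"
      proof -
        show "closure ?W \<subseteq> cball c r" by (rule closure_minimal) auto
        show "closure ?W \<subseteq> closure V" by (rule closure_mono) auto
      qed (use V(1) in \<open>auto intro: bounded_subset[OF bounded_ball]\<close>)
      have "p x \<le> h x"
      proof (rule comparison_principle[OF W(1,2)])
        show "continuous_on (closure ?W) p" by (rule continuous_on_subset[OF p(1) W(3)])
        show "continuous_on (closure ?W) h" by (rule continuous_on_subset[OF V(3) W(4)])
        show "C_k_on 2 p ?W" "C_k_on 2 h ?W"
          using C2_subset[of p "ball c r" ?W] p(2) C2_subset[OF V(4), of ?W] by (simp_all add: harmonic_on_def)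
        show "laplacian h x \<le> laplacian p x" if "x \<in> ?W" for x
          using V(5) that p(2) by (auto simp: harmonic_on_def)
        show "x \<in> closure ?W" using x True closure_subset[of ?W] by auto
        fix y assume y: "y \<in> frontier ?W"
        then have y': "y \<in> closure ?W" "y \<notin> ?W"
          unfolding frontier_of_open[OF W(1)] by auto
        then have "v y = p y" using W(3) vp by blast
        \<comment> \<open>A frontier point of \<open>?W\<close> lies either in \<open>V\<close>,
          hence outside the ball, where \<open>v = u \<le> h\<close> is already known, or on the
          frontier of \<open>V\<close>, where \<open>v \<le> h\<close> is assumed.\<close>
        moreover have "v y \<le> h y"
        proof (cases "y \<in> V")
          case True
          then show ?thesis using y' vu uh by simp
        next
          case False
          then have "y \<in> frontier V" unfolding frontier_of_open[OF V(1)] using y' W(4) by auto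
          then show ?thesis by (rule V(6))
        qed
        ultimately show "p y \<le> h y" by simp
      qed
      then show ?thesis using vp True by simp
    qed
  qed
  moreover have "harmonic_on (ball c r) v"
    by (rule harmonic_on_cong[OF open_ball p(2)]) (simp add: vp)
  ultimately show ?thesis using uv vu by blast
qed

text \<open>A Gaussian about the centre of the exterior ball, subtracted from its value at \<xi>. It
  is smooth on the whole space and has the same form in every dimension, unlike a barrier built from
  the fundamental solution.\<close>

lemma exterior_sphere_barrier:
  fixes \<Omega> :: "(real ^ 'n) set"
  assumes "exterior_sphere_condition_at \<Omega> \<xi>" "\<xi> \<notin> \<Omega>"
  shows "\<exists>b. C_k_on 2 b UNIV \<and> (\<forall>x\<in>\<Omega>. laplacian b x \<le> 0) \<and> b \<xi> = 0 \<and>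
    (\<forall>x\<in>closure \<Omega> - {\<xi>}. 0 < b x)"
proof -
  obtain z R where R: "R > 0" "cball z R \<inter> closure \<Omega> = {\<xi>}"
    using assms unfolding exterior_sphere_condition_at_def by blast
  define n where "n = real CARD('n)"
  \<comment> \<open>The Laplacian of the Gaussian has the sign of
    \<open>2 * \<alpha> * (norm (x - z))\<^sup>2 - n\<close>; this choice makes it vanish at
    distance \<open>R\<close> and nonnegative beyond.\<close>
  define \<alpha> where "\<alpha> = n / (2 * R\<^sup>2)"
  have \<alpha>: "\<alpha> > 0" "2 * \<alpha> * R\<^sup>2 = n" using R by (auto simp: \<alpha>_def n_def)
  define b where "b = (\<lambda>x. exp (- \<alpha> * (norm (\<xi> - z))\<^sup>2) - exp (- \<alpha> * (norm (x - z))\<^sup>2))"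
  have C: "C_k_on 2 (\<lambda>x. exp (- \<alpha> * (norm (x - z))\<^sup>2)) UNIV"
    and L: "laplacian (\<lambda>x. exp (- \<alpha> * (norm (x - z))\<^sup>2)) x =
      (- \<alpha> * exp (- \<alpha> * (norm (x - z))\<^sup>2)) * (2 * n) +
      (\<alpha>\<^sup>2 * exp (- \<alpha> * (norm (x - z))\<^sup>2)) * (norm (2 *\<^sub>R (x - z)))\<^sup>2" for x
  proof -
    have d: "((\<lambda>s. exp (- \<alpha> * s)) has_real_derivative - \<alpha> * exp (- \<alpha> * s)) (at s)"
      "((\<lambda>s. - \<alpha> * exp (- \<alpha> * s)) has_real_derivative \<alpha>\<^sup>2 * exp (- \<alpha> * s)) (at s)" for s
      by (auto intro!: derivative_eq_intros simp: power2_eq_square)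
    have c: "continuous_on UNIV (\<lambda>s. \<alpha>\<^sup>2 * exp (- \<alpha> * s))" by (intro continuous_intros)
    show "C_k_on 2 (\<lambda>x. exp (- \<alpha> * (norm (x - z))\<^sup>2)) UNIV"
      by (rule C2_compose[OF open_UNIV C2_norm_sq subset_UNIV d c])
    show "laplacian (\<lambda>x. exp (- \<alpha> * (norm (x - z))\<^sup>2)) x =
      (- \<alpha> * exp (- \<alpha> * (norm (x - z))\<^sup>2)) * (2 * n) +
      (\<alpha>\<^sup>2 * exp (- \<alpha> * (norm (x - z))\<^sup>2)) * (norm (2 *\<^sub>R (x - z)))\<^sup>2"
      using laplacian_compose[OF open_UNIV C2_norm_sq subset_UNIV d c UNIV_I, of z x]
      unfolding laplacian_norm_sq gradient_norm_sq n_def by simp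
  qed
  have far: "norm (x - z) > R" if "x \<in> closure \<Omega>" "x \<noteq> \<xi>" for x
    using R(2) that by (auto simp: dist_norm norm_minus_commute set_eq_iff not_le[symmetric])
  have near: "norm (\<xi> - z) \<le> R" "\<xi> \<in> closure \<Omega>"
    using R(2) by (auto simp: dist_norm norm_minus_commute set_eq_iff)
  have "laplacian b x \<le> 0" if x: "norm (x - z) \<ge> R" for x
  proof -
    have "laplacian b x = 0 - laplacian (\<lambda>x. exp (- \<alpha> * (norm (x - z))\<^sup>2)) x"
      unfolding b_def using laplacian_diff[OF open_UNIV C2_const C UNIV_I]
      by (simp add: laplacian_const)
    also have "\<dots> = - (2 * \<alpha> * exp (- \<alpha> * (norm (x - z))\<^sup>2) * (2 * \<alpha> * (norm (x - z))\<^sup>2 - n))"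
      unfolding L norm_scaleR power_mult_distrib by (simp add: power2_eq_square algebra_simps)
    also have "\<dots> \<le> 0"
    proof -
      have "R\<^sup>2 \<le> (norm (x - z))\<^sup>2" using x R(1) by (intro power_mono) auto
      then have "2 * \<alpha> * R\<^sup>2 \<le> 2 * \<alpha> * (norm (x - z))\<^sup>2" using \<alpha>(1) by (intro mult_left_mono) auto
      then show ?thesis using \<alpha> by simp
    qed
    finally show ?thesis .
  qed
  moreover have "norm (x - z) \<ge> R" if "x \<in> \<Omega>" for x
    using far[of x] that assms(2) closure_subset[of \<Omega>] by fastforce
  moreover have "C_k_on 2 b UNIV" unfolding b_def by (intro C2_diff C2_const C open_UNIV)
  moreover have "0 < b x" if "x \<in> closure \<Omega> - {\<xi>}" for x
  proof -
    have "norm (\<xi> - z) < norm (x - z)" using far[of x] near that by auto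
    then have "(norm (\<xi> - z))\<^sup>2 < (norm (x - z))\<^sup>2" by (intro power_strict_mono) auto
    then show ?thesis using \<alpha>(1) by (simp add: b_def)
  qed
  ultimately show ?thesis by (intro exI[of _ b]) (auto simp: b_def)
qed

section \<open>The Dirichlet problem on bounded open sets\<close>

lemma harmonic_continuous_at: "open S \<Longrightarrow> harmonic_on S u \<Longrightarrow> x \<in> S \<Longrightarrow> continuous (at x) u"
  using C2_continuous continuous_on_eq_continuous_at unfolding harmonic_on_def by blast

lemma dirichlet_problem_subharmonic:
  fixes \<Omega> :: "(real ^ 'n) set"
  assumes \<Omega>: "open \<Omega>" "bounded \<Omega>" "\<Omega> \<noteq> {}"
    and ext: "\<And>\<xi>. \<xi> \<in> frontier \<Omega> \<Longrightarrow> exterior_sphere_condition_at \<Omega> \<xi>"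
    and p: "continuous_on (closure \<Omega>) p" "C_k_on 2 p \<Omega>" "\<And>x. x \<in> \<Omega> \<Longrightarrow> 0 \<le> laplacian p x"
  shows "\<exists>v. continuous_on (closure \<Omega>) v \<and> harmonic_on \<Omega> v \<and> (\<forall>x\<in>frontier \<Omega>. v x = p x)"
proof -
  have fr: "x \<notin> \<Omega>" "x \<in> closure \<Omega>" if "x \<in> frontier \<Omega>" for x
    using that by (auto simp: frontier_of_open[OF \<Omega>(1)])
  have cl: "x \<in> \<Omega> \<or> x \<in> frontier \<Omega>" if "x \<in> closure \<Omega>" for x
    using that by (auto simp: frontier_of_open[OF \<Omega>(1)])
  have sc: "x \<in> closure \<Omega>" if "x \<in> \<Omega>" for x using that closure_subset by blast
  have "bounded (p ` closure \<Omega>)"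
    using \<Omega>(2) p(1) by (intro compact_imp_bounded compact_continuous_image) (auto simp: compact_closure)
  then obtain M where M: "\<And>x. x \<in> closure \<Omega> \<Longrightarrow> \<bar>p x\<bar> \<le> M" by (auto simp: bounded_iff)

  \<comment> \<open>Harmonic replacement asks for closed balls inside \<Omega>; the Lindelof
    property leaves countably many that still cover it.\<close>
  define F where "F = {ball c r |c r. r > 0 \<and> cball c r \<subseteq> \<Omega>}"
  have "open B" if "B \<in> F" for B using that by (auto simp: F_def)
  from Lindelof[OF this] obtain F' where F': "F' \<subseteq> F" "countable F'" "\<Union>F' = \<Union>F" .
  have UF: "\<Omega> \<subseteq> \<Union>F"
  proof
    fix x assume "x \<in> \<Omega>"
    then obtain r where "r > 0" "cball x r \<subseteq> \<Omega>" using \<Omega>(1) open_contains_cball by blast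
    then show "x \<in> \<Union>F" by (auto simp: F_def intro!: exI[of _ "ball x r"])
  qed
  then have "F' \<noteq> {}" using F'(3) \<Omega>(3) by auto
  then have "\<exists>c r. from_nat_into F' k = ball c r \<and> r > 0 \<and> cball c r \<subseteq> \<Omega>" for k
    using from_nat_into[of F' k] F'(1) by (auto simp: F_def)
  then obtain c r where cr: "\<And>k. from_nat_into F' k = ball (c k) (r k)" "\<And>k. r k > 0"
    "\<And>k. cball (c k) (r k) \<subseteq> \<Omega>" by metis
  have cover: "\<exists>k. x \<in> ball (c k) (r k)" if x: "x \<in> \<Omega>" for x
  proof -
    obtain B where "B \<in> F'" "x \<in> B" using UF x F'(3) by blast
    then show ?thesis using from_nat_into_surj[OF F'(2), of B] cr(1) by metis
  qed

  \<comment> \<open>The first component of the decoded pair is the index of the ball, so ball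
    \<open>k\<close> is swept at every time \<open>prod_encode (k, j)\<close>, that is, infinitely
    often.\<close>
  define B where "B = (\<lambda>n. ball (c (fst (prod_decode n))) (r (fst (prod_decode n))))"
  have "\<exists>U. \<forall>n. (subsolution \<Omega> (U n) \<and> (\<forall>x\<in>frontier \<Omega>. U n x = p x) \<and> (\<forall>x. p x \<le> U n x)) \<and>
      ((\<forall>x. U n x \<le> U (Suc n) x) \<and> harmonic_on (B n) (U (Suc n)))"
  proof (rule dependent_nat_choice)
    show "\<exists>u. subsolution \<Omega> u \<and> (\<forall>x\<in>frontier \<Omega>. u x = p x) \<and> (\<forall>x. p x \<le> u x)"
      using subsolution_of_subharmonic[OF \<Omega>(2) p] by blast
    fix u n
    assume u: "subsolution \<Omega> u \<and> (\<forall>x\<in>frontier \<Omega>. u x = p x) \<and> (\<forall>x. p x \<le> u x)"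
    let ?k = "fst (prod_decode n)"
    from subsolution_harmonic_replacement[OF \<Omega>(1,2) _ cr(2) cr(3), of u ?k] u
    obtain v where v: "subsolution \<Omega> v" "\<And>x. u x \<le> v x" "\<And>x. x \<notin> B n \<Longrightarrow> v x = u x"
      "harmonic_on (B n) v" unfolding B_def by blast
    have "x \<notin> B n" if "x \<in> frontier \<Omega>" for x
      using fr(1)[OF that] cr(3)[of ?k] ball_subset_cball unfolding B_def by blast
    then have "\<forall>x\<in>frontier \<Omega>. v x = p x" using v(3) u by auto
    moreover have "\<forall>x. p x \<le> v x" using v(2) u order_trans by blast
    ultimately show "\<exists>v. (subsolution \<Omega> v \<and> (\<forall>x\<in>frontier \<Omega>. v x = p x) \<and> (\<forall>x. p x \<le> v x)) \<and>
        ((\<forall>x. u x \<le> v x) \<and> harmonic_on (B n) v)"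
      using v by blast
  qed
  then obtain U where U: "\<And>n. subsolution \<Omega> (U n)" "\<And>n x. x \<in> frontier \<Omega> \<Longrightarrow> U n x = p x"
    "\<And>n x. p x \<le> U n x" "\<And>n x. U n x \<le> U (Suc n) x" "\<And>n. harmonic_on (B n) (U (Suc n))"
    by blast
  \<comment> \<open>The only upper bound on the iterates; it is used with the constant
    \<open>M\<close> and with \<open>a' + K * b\<close>.\<close>
  have U_le: "U n x \<le> h x" if "C_k_on 2 h UNIV" "\<And>x. x \<in> \<Omega> \<Longrightarrow> laplacian h x \<le> 0"
    "\<And>x. x \<in> frontier \<Omega> \<Longrightarrow> p x \<le> h x" "x \<in> closure \<Omega>" for h n x
  proof (cases "x \<in> \<Omega>")
    case True
    show ?thesis
    proof (rule subsolutionD[OF U(1) \<Omega>(1) subset_refl _ _ that(2) _ True])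
      show "continuous_on (closure \<Omega>) h" using C2_continuous[OF that(1)] continuous_on_subset by blast
      show "C_k_on 2 h \<Omega>" using C2_subset[OF that(1)] by blast
      show "U n x \<le> h x" if "x \<in> frontier \<Omega>" for x using U(2)[OF that] \<open>\<And>x. x \<in> frontier \<Omega> \<Longrightarrow> p x \<le> h x\<close>[OF that] by simp
    qed
  next
    case False
    then have "x \<in> frontier \<Omega>" using cl that(4) by blast
    then show ?thesis using U(2) that(3) by simp
  qed
  have UM: "U n x \<le> M" if "x \<in> closure \<Omega>" for n x
    using U_le[OF C2_const, of M x n] M fr(2) that by (auto simp: laplacian_const abs_le_iff)
  have inc: "incseq (\<lambda>n. U n x)" for x using U(4) by (intro incseq_SucI)
  define v where "v = (\<lambda>x. lim (\<lambda>n. U n x))"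
  have lim: "(\<lambda>n. U n x) \<longlonglongrightarrow> v x" if "x \<in> closure \<Omega>" for x
    unfolding v_def convergent_LIMSEQ_iff[symmetric]
    using incseq_convergent[OF inc, of x M] UM[OF that] unfolding convergent_def by blast
  have vp: "v x = p x" if "x \<in> frontier \<Omega>" for x
    using lim[OF fr(2)[OF that]] U(2)[OF that] by (simp add: LIMSEQ_const_iff)
  have pv: "p x \<le> v x" if "x \<in> closure \<Omega>" for x
    by (rule LIMSEQ_le_const[OF lim[OF that]]) (use U(3) in auto)

  have harm: "harmonic_on \<Omega> v"
  proof (rule harmonic_on_local)
    fix x assume x: "x \<in> \<Omega>"
    then obtain k where k: "x \<in> ball (c k) (r k)" using cover by blast
    have sub: "y \<in> closure \<Omega>" if "y \<in> ball (c k) (r k)" for y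
      using that cr(3)[of k] sc ball_subset_cball by blast
    \<comment> \<open>The successor enters because sweeping over \<open>B n\<close> makes
      \<open>U (Suc n)\<close> harmonic there; along this subsequence every term is harmonic on ball
      \<open>k\<close>.\<close>
    let ?s = "\<lambda>j. Suc (prod_encode (k, j))"
    have fl: "filterlim ?s at_top sequentially"
      by (rule filterlim_at_top_mono[OF filterlim_ident])
        (auto intro!: always_eventually le_SucI le_prod_encode_2)
    have "harmonic_on (ball (c k) (r k)) v"
    proof (rule harmonic_pointwise_limit[OF open_ball])
      show "harmonic_on (ball (c k) (r k)) (U (?s j))" for j
        using U(5)[of "prod_encode (k, j)"] by (simp add: B_def)
      show "\<bar>U (?s j) y\<bar> \<le> M" if "y \<in> ball (c k) (r k)" for j y
        using UM[OF sub[OF that], of "?s j"] M[OF sub[OF that]] U(3)[of y "?s j"] by linarith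
      show "(\<lambda>j. U (?s j) y) \<longlonglongrightarrow> v y" if "y \<in> ball (c k) (r k)" for y
        by (rule filterlim_compose[OF lim[OF sub[OF that]] fl])
    qed
    with k show "\<exists>T. open T \<and> x \<in> T \<and> harmonic_on T v" by (intro exI[of _ "ball (c k) (r k)"]) auto
  qed

  have "continuous_on (closure \<Omega>) v"
    unfolding continuous_on_def
  proof
    fix \<xi> assume \<xi>: "\<xi> \<in> closure \<Omega>"
    show "(v \<longlongrightarrow> v \<xi>) (at \<xi> within closure \<Omega>)"
    proof (cases "\<xi> \<in> \<Omega>")
      case True
      then have "continuous (at \<xi>) v" by (rule harmonic_continuous_at[OF \<Omega>(1) harm])
      then have "continuous (at \<xi> within closure \<Omega>) v" by (rule continuous_at_imp_continuous_at_within)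
      then show ?thesis by (simp add: continuous_within)
    next
      case False
      then have \<xi>f: "\<xi> \<in> frontier \<Omega>" using cl[OF \<xi>] by blast
      have ev: "eventually (\<lambda>x. x \<in> closure \<Omega>) (at \<xi> within closure \<Omega>)"
        by (simp add: eventually_at_filter)
      obtain b where b: "C_k_on 2 b UNIV" "\<And>x. x \<in> \<Omega> \<Longrightarrow> laplacian b x \<le> 0" "b \<xi> = 0"
        "\<And>x. x \<in> closure \<Omega> \<Longrightarrow> x \<noteq> \<xi> \<Longrightarrow> 0 < b x"
        using exterior_sphere_barrier[OF ext[OF \<xi>f] False] by blast
      have cb: "continuous_on S b" for S using C2_continuous[OF b(1)] continuous_on_subset by blast
      have b0: "0 \<le> b x" if "x \<in> closure \<Omega>" for x using b(3) b(4)[OF that] by (cases "x = \<xi>") auto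
      show ?thesis unfolding vp[OF \<xi>f]
      proof (rule order_tendstoI)
        \<comment> \<open>The lower half rests on \<open>p \<le> v\<close> and the continuity of
          \<open>p\<close>.\<close>
        fix a assume "a < p \<xi>"
        moreover have "(p \<longlongrightarrow> p \<xi>) (at \<xi> within closure \<Omega>)" using p(1) \<xi> by (simp add: continuous_on_def)
        ultimately have "eventually (\<lambda>x. a < p x) (at \<xi> within closure \<Omega>)" by (rule order_tendstoD(1)[rotated])
        then show "eventually (\<lambda>x. a < v x) (at \<xi> within closure \<Omega>)"
          using ev by eventually_elim (use pv in force)
      next
        fix a assume a: "p \<xi> < a"
        \<comment> \<open>The gap between \<open>a'\<close> and \<open>a\<close> absorbs
          \<open>K * b x\<close> near \<xi>, while \<open>p \<xi> < a'\<close> keeps the set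
          \<open>T\<close> below away from \<xi>.\<close>
        define a' where "a' = (p \<xi> + a) / 2"
        have a': "p \<xi> < a'" "a' < a" using a by (auto simp: a'_def)
        have "\<exists>K\<ge>0. \<forall>x\<in>frontier \<Omega>. p x \<le> a' + K * b x"
        proof -
          \<comment> \<open>The barrier has to help only where \<open>p \<ge> a'\<close>. This part
            of the frontier is compact and misses \<xi>, so \<open>b\<close> has a positive minimum
            on it, and \<open>2 * M\<close> bounds \<open>p x - p \<xi>\<close>.\<close>
          define T where "T = frontier \<Omega> \<inter> p -` {a'..}"
          have "closed T" unfolding T_def
            by (intro continuous_closed_preimage continuous_on_subset[OF p(1)]) (auto intro: fr)
          moreover have "bounded T"
            using bounded_subset[OF bounded_closure[OF \<Omega>(2)], of T] fr(2) by (auto simp: T_def)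
          ultimately have "compact T" by (simp add: compact_eq_bounded_closed)
          show ?thesis
          proof (cases "T = {}")
            case True
            then have "p x \<le> a'" if "x \<in> frontier \<Omega>" for x using that by (force simp: T_def)
            then show ?thesis by (intro exI[of _ 0]) auto
          next
            case False
            then obtain t where t: "t \<in> T" "\<And>x. x \<in> T \<Longrightarrow> b t \<le> b x"
              using continuous_attains_inf[OF \<open>compact T\<close> False cb] by blast
            have "t \<noteq> \<xi>" using t(1) a' by (auto simp: T_def)
            then have bt: "b t > 0" using b(4) t(1) fr(2) by (auto simp: T_def)
            have M0: "M \<ge> 0" using M[OF \<xi>] by linarith
            have "p x \<le> a' + (2 * M / b t) * b x" if x: "x \<in> frontier \<Omega>" for x
            proof (cases "x \<in> T")
              case True
              have "(2 * M / b t) * b t \<le> (2 * M / b t) * b x"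
                using t(2)[OF True] M0 bt by (intro mult_left_mono) auto
              then have "2 * M \<le> (2 * M / b t) * b x" using bt by simp
              then show ?thesis using M[OF \<xi>] M[OF fr(2)[OF x]] a'(1) by linarith
            next
              case False
              then have "p x \<le> a'" using x by (auto simp: T_def)
              moreover have "(2 * M / b t) * b x \<ge> 0" using M0 bt b0[OF fr(2)[OF x]] by simp
              ultimately show ?thesis by linarith
            qed
            then show ?thesis using M0 bt by (intro exI[of _ "2 * M / b t"]) auto
          qed
        qed
        then obtain K where K: "K \<ge> 0" "\<And>x. x \<in> frontier \<Omega> \<Longrightarrow> p x \<le> a' + K * b x" by blast
        have "U n x \<le> a' + K * b x" if "x \<in> closure \<Omega>" for n x
        proof (rule U_le[OF _ _ K(2) that])
          show "C_k_on 2 (\<lambda>x. a' + K * b x) UNIV" by (intro C2_add C2_const C2_cmult b(1) open_UNIV)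
          show "laplacian (\<lambda>x. a' + K * b x) x \<le> 0" if "x \<in> \<Omega>" for x
            using b(2)[OF that] K(1) laplacian_add[OF open_UNIV C2_const C2_cmult[OF open_UNIV b(1)], of x a' K]
              laplacian_cmult[OF open_UNIV b(1), of x K]
            by (simp add: laplacian_const mult_nonneg_nonpos)
        qed
        then have vle: "v x \<le> a' + K * b x" if "x \<in> closure \<Omega>" for x
          by (intro LIMSEQ_le_const2[OF lim[OF that]]) (use that in blast)
        have "((\<lambda>x. a' + K * b x) \<longlongrightarrow> a' + K * b \<xi>) (at \<xi> within closure \<Omega>)"
          using cb[of "closure \<Omega>"] \<xi> unfolding continuous_on_def by (intro tendsto_intros) blast
        then have "eventually (\<lambda>x. a' + K * b x < a) (at \<xi> within closure \<Omega>)"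
          using a'(2) b(3) by (intro order_tendstoD(2)) auto
        then show "eventually (\<lambda>x. v x < a) (at \<xi> within closure \<Omega>)"
          using ev by eventually_elim (use vle in force)
      qed
    qed
  qed
  with harm vp show ?thesis by blast
qed

text \<open>Writes \<open>p\<close> as \<open>(p + s) - s\<close> with both \<open>p + s\<close> and
  \<open>s\<close> subharmonic; the difference of the two solutions has the boundary values
  \<open>p\<close>.\<close>

lemma dirichlet_problem_polynomial:
  fixes \<Omega> :: "(real ^ 'n) set"
  assumes \<Omega>: "open \<Omega>" "bounded \<Omega>" "\<Omega> \<noteq> {}"
    and ext: "\<And>\<xi>. \<xi> \<in> frontier \<Omega> \<Longrightarrow> exterior_sphere_condition_at \<Omega> \<xi>"
    and p: "real_polynomial_function p"
  shows "\<exists>v. continuous_on (closure \<Omega>) v \<and> harmonic_on \<Omega> v \<and> (\<forall>x\<in>frontier \<Omega>. v x = p x)"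
proof -
  note C2p = polynomial_C2[OF p]
  have "continuous_on (closure \<Omega>) (laplacian p)"
    unfolding laplacian_def[abs_def] using p
    by (intro continuous_on_sum C2_continuous polynomial_C2 polynomial_has_partial)
  then have "bounded (laplacian p ` closure \<Omega>)"
    using \<Omega>(2) by (intro compact_imp_bounded compact_continuous_image) (auto simp: compact_closure)
  then obtain A where A: "\<And>x. x \<in> closure \<Omega> \<Longrightarrow> \<bar>laplacian p x\<bar> \<le> A" by (auto simp: bounded_iff)
  obtain z where "z \<in> \<Omega>" using \<Omega>(3) by blast
  then have A0: "A \<ge> 0" using A[of z] closure_subset by force
  \<comment> \<open>The Laplacian of \<open>s\<close> is \<open>2 * n * A\<close> with
    \<open>n\<close> the dimension, which outweighs the bound \<open>A\<close> on that of
    \<open>p\<close>.\<close>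
  define s where "s = (\<lambda>x :: real ^ 'n. A * (norm (x - 0))\<^sup>2)"
  have C2s: "C_k_on 2 s S" if "open S" for S unfolding s_def by (intro C2_cmult C2_norm_sq that)
  have ls: "laplacian s x = A * (2 * CARD('n))" for x
    unfolding s_def laplacian_cmult[OF open_UNIV C2_norm_sq UNIV_I] laplacian_norm_sq by simp
  have cs: "continuous_on (closure \<Omega>) s" "continuous_on (closure \<Omega>) (\<lambda>x. p x + s x)"
    unfolding s_def by (intro continuous_intros C2_continuous C2p)+
  have "0 \<le> laplacian (\<lambda>x. p x + s x) x" if "x \<in> \<Omega>" for x
  proof -
    have "real CARD('n) \<ge> 1" by (simp add: Suc_leI)
    then have "1 \<le> 2 * real CARD('n)" by linarith
    then have "A * 1 \<le> A * (2 * CARD('n))" using A0 by (intro mult_left_mono) auto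
    moreover have "\<bar>laplacian p x\<bar> \<le> A" using A that closure_subset by blast
    ultimately show ?thesis
      using laplacian_add[OF open_UNIV C2p C2s[OF open_UNIV] UNIV_I, of x] ls[of x] by simp
  qed
  then obtain v where v: "continuous_on (closure \<Omega>) v" "harmonic_on \<Omega> v"
    "\<And>x. x \<in> frontier \<Omega> \<Longrightarrow> v x = p x + s x"
    using dirichlet_problem_subharmonic[OF \<Omega> ext cs(2) C2_add[OF \<Omega>(1) C2p C2s[OF \<Omega>(1)]]] by blast
  obtain w where w: "continuous_on (closure \<Omega>) w" "harmonic_on \<Omega> w"
    "\<And>x. x \<in> frontier \<Omega> \<Longrightarrow> w x = s x"
    using dirichlet_problem_subharmonic[OF \<Omega> ext cs(1) C2s[OF \<Omega>(1)]] ls A0 by force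
  show ?thesis
    using v w \<Omega>(1)
    by (intro exI[of _ "\<lambda>x. v x - w x"]) (auto intro: continuous_on_diff harmonic_on_diff)
qed

theorem dirichlet_problem:
  fixes \<Omega> :: "(real ^ 'n) set"
  assumes \<Omega>: "open \<Omega>" "bounded \<Omega>" "\<Omega> \<noteq> {}"
    and ext: "\<And>\<xi>. \<xi> \<in> frontier \<Omega> \<Longrightarrow> exterior_sphere_condition_at \<Omega> \<xi>"
    and g: "continuous_on (frontier \<Omega>) g"
  shows "\<exists>v. continuous_on (closure \<Omega>) v \<and> harmonic_on \<Omega> v \<and> (\<forall>x\<in>frontier \<Omega>. v x = g x)"
proof -
  have "compact (frontier \<Omega>)" using \<Omega>(2) by (rule compact_frontier_bounded)
  then obtain p where p: "\<And>m. real_polynomial_function (p m)" "uniform_limit (frontier \<Omega>) p g sequentially"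
    using polynomial_uniform_approximation[OF _ g] by metis
  obtain q where q: "\<And>m. continuous_on (closure \<Omega>) (q m)" "\<And>m. harmonic_on \<Omega> (q m)"
    "\<And>m x. x \<in> frontier \<Omega> \<Longrightarrow> q m x = p m x"
    using dirichlet_problem_polynomial[OF \<Omega> ext p(1)] by metis
  have ul: "uniform_limit (frontier \<Omega>) q g sequentially"
    using p(2) q(3) by (simp add: uniform_limit_iff)
  let ?v = "\<lambda>x. lim (\<lambda>m. q m x)"
  note A = dirichlet_approximation[OF \<Omega>(1,2) q(1,2) ul]
  \<comment> \<open>The \<open>q m\<close> need not be polynomials, so the limit theorem for
    arbitrary harmonic functions is applied on small balls.\<close>
  have "harmonic_on \<Omega> ?v"
  proof (rule harmonic_on_local)
    fix x assume "x \<in> \<Omega>"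
    then obtain r where r: "r > 0" "cball x r \<subseteq> \<Omega>" using \<Omega>(1) open_contains_cball by blast
    then have sub: "cball x r \<subseteq> closure \<Omega>" using closure_subset by blast
    have "harmonic_on (ball x r) ?v"
    proof (rule harmonic_uniform_limit[OF r(1)])
      show "continuous_on (cball x r) (q m)" for m by (rule continuous_on_subset[OF q(1) sub])
      show "harmonic_on (ball x r) (q m)" for m
        using harmonic_on_subset[OF q(2)] r(2) ball_subset_cball by blast
      show "uniform_limit (cball x r) q ?v sequentially" by (rule uniform_limit_on_subset[OF A(2) sub])
    qed
    with r(1) show "\<exists>T. open T \<and> x \<in> T \<and> harmonic_on T ?v" by (intro exI[of _ "ball x r"]) auto
  qed
  with A(3,4) show ?thesis by blast
qed

section \<open>Reduction to harmonic functions\<close>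

lemma antiderivative_on_open_interval:
  fixes f :: "real \<Rightarrow> real"
  assumes I: "open I" "is_interval I" and f: "continuous_on I f"
  shows "\<exists>F. \<forall>t\<in>I. (F has_real_derivative f t) (at t)"
proof (cases "I = {}")
  case False
  then obtain a where a: "a \<in> I" by blast
  \<comment> \<open>An integral over an empty interval is 0, so this is the oriented integral from
    \<open>a\<close> to \<open>t\<close> on either side of \<open>a\<close>.\<close>
  define F where "F = (\<lambda>t. integral {a..t} f - integral {t..a} f)"
  have "(F has_real_derivative f t) (at t)" if t: "t \<in> I" for t
  proof -
    define m M where "m = min a t" and "M = max a t"
    have mM: "m \<in> I" "M \<in> I" "m \<le> a" "a \<le> M" "m \<le> t" "t \<le> M"
      using a t by (auto simp: m_def M_def min_def max_def)
    obtain d where d: "d > 0" "cball m d \<subseteq> I" using I(1) mM(1) open_contains_cball by blast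
    obtain e where e: "e > 0" "cball M e \<subseteq> I" using I(1) mM(2) open_contains_cball by blast
    define p q where "p = m - d" and "q = M + e"
    have pq: "p \<in> I" "q \<in> I" "p < a" "a < q" "p < t" "t < q"
      using d e mM by (auto simp: p_def q_def subset_iff dist_real_def)
    have sub: "{p..q} \<subseteq> I"
      using pq(1,2) I(2) unfolding is_interval_1 by (meson atLeastAtMost_iff subsetI)
    have c: "continuous_on {p..q} f" by (rule continuous_on_subset[OF f sub])
    have int: "f integrable_on {x..y}" if "p \<le> x" "y \<le> q" for x y
      using that by (intro integrable_continuous_real continuous_on_subset[OF c]) auto
    \<comment> \<open>Near \<open>t\<close> the function differs by a constant from an integral with
      a fixed left end \<open>p\<close> below both \<open>a\<close> and \<open>t\<close>, to which
      the fundamental theorem applies.\<close>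
    have F: "F s = integral {p..s} f - integral {p..a} f" if "s \<in> {p<..<q}" for s
    proof (cases "a \<le> s")
      case True
      have "integral {s..a} f = 0" using True by (cases "s = a") auto
      moreover have "integral {p..a} f + integral {a..s} f = integral {p..s} f"
        using that True pq by (intro Henstock_Kurzweil_Integration.integral_combine int) auto
      ultimately show ?thesis by (simp add: F_def)
    next
      case False
      have "integral {p..s} f + integral {s..a} f = integral {p..a} f"
        using that False pq by (intro Henstock_Kurzweil_Integration.integral_combine int) auto
      then show ?thesis using False by (simp add: F_def)
    qed
    have "((\<lambda>s. integral {p..s} f) has_real_derivative f t) (at t within {p..q})"
      using pq by (intro integral_has_real_derivative[OF c]) auto
    then have "((\<lambda>s. integral {p..s} f) has_real_derivative f t) (at t)"
      using pq at_within_Icc_at[of p t q] by simp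
    then have "((\<lambda>s. integral {p..s} f - integral {p..a} f) has_real_derivative f t) (at t)"
      by (auto intro!: derivative_eq_intros)
    then show ?thesis
      by (rule has_field_derivative_transform_within_open[where S = "{p<..<q}"]) (use pq F in auto)
  qed
  then show ?thesis by blast
qed simp

lemma strict_mono_on_interval:
  fixes F :: "real \<Rightarrow> real"
  assumes "is_interval I" and F: "\<And>t. t \<in> I \<Longrightarrow> (F has_real_derivative f t) (at t)"
    and pos: "\<And>t. t \<in> I \<Longrightarrow> 0 < f t" and st: "s \<in> I" "t \<in> I" "s < t"
  shows "F s < F t"
proof (rule DERIV_pos_imp_increasing[OF st(3)])
  fix x assume "s \<le> x" "x \<le> t"
  then have "x \<in> I" using assms(1) st(1,2) unfolding is_interval_1 by blast
  then show "\<exists>y. DERIV F x :> y \<and> 0 < y" using F pos by blast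
qed

text \<open>The inverse function rule asks for \<open>F (inv_into I F y) = y\<close> near
  \<open>s\<close> and for continuity of the inverse at \<open>s\<close>. The image of
  \<open>I\<close> is open because \<open>F\<close> is continuous and injective, and continuity of
  the inverse comes from that of \<open>F\<close> on a closed interval about the preimage.\<close>

lemma has_derivative_inv_into:
  fixes F :: "real \<Rightarrow> real"
  assumes I: "open I" "is_interval I"
    and F: "\<And>t. t \<in> I \<Longrightarrow> (F has_real_derivative f t) (at t)"
    and pos: "\<And>t. t \<in> I \<Longrightarrow> 0 < f t" and s: "s \<in> F ` I"
  shows "(inv_into I F has_real_derivative inverse (f (inv_into I F s))) (at s)"
proof -
  have inj: "inj_on F I"
    using strict_mono_on_interval[OF I(2) F pos] by (intro linorder_inj_onI) (auto simp: less_le)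
  obtain t where t: "t \<in> I" "s = F t" using s by blast
  have cF: "continuous_on I F" using F by (intro continuous_at_imp_continuous_on ballI DERIV_isCont) auto
  have "open (F ` I)" by (rule injective_into_1d_imp_open_map_UNIV[OF I(1) cF inj subset_refl])
  then obtain e where e: "e > 0" "ball s e \<subseteq> F ` I" using s openE by blast
  obtain d where d: "d > 0" "cball t d \<subseteq> I" using I(1) t(1) open_contains_cball by blast
  have cont: "isCont (inv_into I F) (F t)"
  proof (rule isCont_inverse_function[where f = F and x = t, OF d(1)])
    fix z assume "\<bar>z - t\<bar> \<le> d"
    then have "z \<in> I" using d(2) by (auto simp: subset_iff dist_real_def abs_minus_commute)
    then show "inv_into I F (F z) = z" "isCont F z" using inj F DERIV_isCont by auto
  qed
  show ?thesis
  proof (rule DERIV_inverse_function[where a = "s - e" and b = "s + e"])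
    show "(F has_real_derivative f (inv_into I F s)) (at (inv_into I F s))"
      by (rule F[OF inv_into_into[OF s]])
    show "f (inv_into I F s) \<noteq> 0" using pos[OF inv_into_into[OF s]] by simp
    show "F (inv_into I F y) = y" if "s - e < y" "y < s + e" for y
    proof -
      have "y \<in> F ` I" using that e(2) by (auto simp: subset_iff dist_real_def abs_less_iff)
      then show ?thesis by (rule f_inv_into_f)
    qed
    show "isCont (inv_into I F) s" using cont t(2) by simp
  qed (use e in auto)
qed

text \<open>Values lie between the extremes that \<open>v\<close> attains on the compact frontier,
  and both are in \<open>J\<close>. Because they are attained, \<open>J\<close> may be any interval;
  in the application it is the image of \<open>I\<close> under \<open>F\<close>, which can be a
  proper part of the line.\<close>

lemma range_le_boundary_range:
  fixes v :: "real ^ 'n \<Rightarrow> real"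
  assumes V: "open V" "bounded V" "V \<noteq> {}" and v: "continuous_on (closure V) v" "harmonic_on V v"
    and J: "is_interval J" "v ` frontier V \<subseteq> J"
  shows "v ` closure V \<subseteq> J"
proof
  fix s assume "s \<in> v ` closure V"
  then obtain x where x: "x \<in> closure V" "s = v x" by blast
  have K: "compact (frontier V)" using V(2) by (rule compact_frontier_bounded)
  have "V \<noteq> UNIV" using V(2) not_bounded_UNIV by auto
  then have ne: "frontier V \<noteq> {}" using frontier_not_empty[of V] V(3) by blast
  have cv: "continuous_on (frontier V) v"
    by (rule continuous_on_subset[OF v(1)]) (auto simp: frontier_def)
  obtain a where a: "a \<in> frontier V" "\<And>y. y \<in> frontier V \<Longrightarrow> v a \<le> v y"
    using continuous_attains_inf[OF K ne cv] by blast
  obtain b where b: "b \<in> frontier V" "\<And>y. y \<in> frontier V \<Longrightarrow> v y \<le> v b"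
    using continuous_attains_sup[OF K ne cv] by blast
  have C2: "C_k_on 2 v V" and lap: "\<And>x. x \<in> V \<Longrightarrow> laplacian v x = 0"
    using v(2) by (auto simp: harmonic_on_def)
  have "v x \<le> v b"
    by (rule comparison_principle[OF V(1,2) v(1) _ C2 C2_const _ b(2) x(1)])
      (auto simp: lap laplacian_const)
  moreover have "v a \<le> v x"
    by (rule comparison_principle[OF V(1,2) _ v(1) C2_const C2 _ a(2) x(1)])
      (auto simp: lap laplacian_const)
  moreover have "v a \<in> J" "v b \<in> J" using J(2) a(1) b(1) by auto
  ultimately show "s \<in> J" using J(1) x(2) unfolding is_interval_1 by blast
qed

theorem proposition4p11:
  fixes \<Omega> :: "(real ^ 'n) set" and I :: "real set" and H :: "real \<Rightarrow> real"
  assumes "domain \<Omega>" and "bounded \<Omega>"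
    and "\<forall>\<xi>\<in>frontier \<Omega>. exterior_sphere_condition_at \<Omega> \<xi>"
    and "open I" and "is_interval I"
    and "C_k_on_real 3 H I"
    and "\<forall>t\<in>I. (deriv ^^ 3) H t * deriv H t * (1 + (deriv H t)\<^sup>2)
                 + ((deriv ^^ 2) H t)\<^sup>2 * (1 - (deriv H t)\<^sup>2) \<le> 0"
  shows "\<forall>g :: real ^ 'n \<Rightarrow> real.
           continuous_on (frontier \<Omega>) g \<and> g ` frontier \<Omega> \<subseteq> I \<longrightarrow>
             (\<exists>y. dirichlet_solution \<Omega> I H g y) \<and>
             (\<forall>y z. dirichlet_solution \<Omega> I H g y \<and> dirichlet_solution \<Omega> I H g z \<longrightarrow>
                (\<forall>x\<in>closure \<Omega>. y x = z x))"
proof (intro allI impI)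
  fix g :: "real ^ 'n \<Rightarrow> real"
  assume "continuous_on (frontier \<Omega>) g \<and> g ` frontier \<Omega> \<subseteq> I"
  then have g: "continuous_on (frontier \<Omega>) g" "g ` frontier \<Omega> \<subseteq> I" by auto
  have \<Omega>: "open \<Omega>" "bounded \<Omega>" "\<Omega> \<noteq> {}" using assms(1,2) by (auto simp: domain_def)
  have H: "((deriv ^^ j) H has_real_derivative (deriv ^^ Suc j) H t) (at t)" if "t \<in> I" "j < 3" for t j
    using assms(6) that by (auto simp: C_k_on_real_def DERIV_deriv_iff_real_differentiable)
  have H1: "(deriv H has_real_derivative (deriv ^^ 2) H t) (at t)" if "t \<in> I" for t
    using H[OF that, of 1] by (simp add: numeral_2_eq_2)
  have cH: "continuous_on I (deriv H)" "continuous_on I ((deriv ^^ 2) H)"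
    using H1 H[of _ 2] by (auto intro!: continuous_at_imp_continuous_on DERIV_isCont)
  \<comment> \<open>\<open>F1\<close> will be the derivative of \<open>F\<close>, and
    \<open>F2\<close> is the derivative of \<open>F1\<close>.\<close>
  define F1 where "F1 = (\<lambda>t. sqrt (1 + (deriv H t)\<^sup>2))"
  define F2 where "F2 = (\<lambda>t. (deriv ^^ 2) H t * deriv H t / F1 t)"
  have F1pos: "F1 t > 0" for t by (simp add: F1_def add_pos_nonneg)
  have F1sq: "F1 t * F1 t = 1 + (deriv H t)\<^sup>2" for t by (simp add: F1_def)
  have cF1: "continuous_on I F1" unfolding F1_def by (intro continuous_intros cH)
  have cF2: "continuous_on I F2"
    unfolding F2_def by (intro continuous_intros cH cF1) (metis F1pos less_irrefl)
  have dF1: "(F1 has_real_derivative F2 t) (at t)" if "t \<in> I" for t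
  proof -
    have "1 + (deriv H t)\<^sup>2 > 0" by (simp add: add_pos_nonneg)
    then show ?thesis
      unfolding F1_def F2_def using H1[OF that]
      by (auto intro!: derivative_eq_intros simp: field_simps)
  qed
  obtain F where dF: "\<And>t. t \<in> I \<Longrightarrow> (F has_real_derivative F1 t) (at t)"
    using antiderivative_on_open_interval[OF assms(4,5) cF1] by blast
  have cF: "continuous_on I F" using dF by (intro continuous_at_imp_continuous_on ballI DERIV_isCont) auto
  have inj: "inj_on F I"
    using strict_mono_on_interval[OF assms(5) dF F1pos] by (intro linorder_inj_onI) (auto simp: less_le)
  \<comment> \<open>The chain rule produces \<open>F1 (y x)\<close> times the difference of the two
    sides of the equation, and \<open>F1\<close> is positive.\<close>
  have pde: "laplacian (\<lambda>x. F (y x)) x = 0 \<longleftrightarrow>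
      laplacian y x = - (((deriv ^^ 2) H (y x) * deriv H (y x)) / (1 + (deriv H (y x))\<^sup>2))
        * (norm (gradient y x))\<^sup>2"
    if "C_k_on 2 y \<Omega>" "y ` \<Omega> \<subseteq> I" "x \<in> \<Omega>" for y :: "real ^ 'n \<Rightarrow> real" and x
  proof -
    let ?P = "(deriv ^^ 2) H (y x) * deriv H (y x)" and ?N = "(norm (gradient y x))\<^sup>2"
    have "F2 (y x) = F1 (y x) * (?P / (1 + (deriv H (y x))\<^sup>2))"
      unfolding F1sq[symmetric] F2_def using F1pos[of "y x"] by simp
    then have "laplacian (\<lambda>x. F (y x)) x =
        F1 (y x) * (laplacian y x + ?P / (1 + (deriv H (y x))\<^sup>2) * ?N)"
      using laplacian_compose[OF \<Omega>(1) that(1,2) dF dF1 cF2 that(3)] by (simp add: distrib_left)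
    then show ?thesis using F1pos[of "y x"] by (auto simp: add_eq_0_iff)
  qed
  have sub: "\<Omega> \<subseteq> closure \<Omega>" by (rule closure_subset)

  have "\<exists>y. dirichlet_solution \<Omega> I H g y"
  proof -
    have "continuous_on (frontier \<Omega>) (\<lambda>x. F (g x))" by (rule continuous_on_compose2[OF cF g])
    then obtain v where v: "continuous_on (closure \<Omega>) v" "harmonic_on \<Omega> v"
      "\<And>x. x \<in> frontier \<Omega> \<Longrightarrow> v x = F (g x)"
      using dirichlet_problem[OF \<Omega>] assms(3) by blast
    \<comment> \<open>Keeps the values of \<open>v\<close> where the inverse of \<open>F\<close> is
      defined and smooth.\<close>
    have "is_interval (F ` I)"
      using connected_continuous_image[OF cF] assms(5) by (simp add: is_interval_connected_1)
    then have vI: "v ` closure \<Omega> \<subseteq> F ` I"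
      using g(2) v(3) by (intro range_le_boundary_range[OF \<Omega> v(1,2)]) auto
    then have vI': "v ` \<Omega> \<subseteq> F ` I" using sub by blast
    define G where "G = inv_into I F"
    have FG: "F (G s) = s" "G s \<in> I" if "s \<in> F ` I" for s
      using that by (auto simp: G_def f_inv_into_f inv_into_into)
    have dG: "(G has_real_derivative inverse (F1 (G s))) (at s)" if "s \<in> F ` I" for s
      unfolding G_def by (rule has_derivative_inv_into[OF assms(4,5) dF F1pos that])
    \<comment> \<open>The second derivative of the inverse: the derivative of
      \<open>inverse (F1 (G s))\<close> in the form in which \<open>DERIV_inverse'\<close> and the
      chain rule produce it.\<close>
    define G2 where "G2 = (\<lambda>s. - (inverse (F1 (G s)) * (F2 (G s) * inverse (F1 (G s))) * inverse (F1 (G s))))"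
    have dG1: "((\<lambda>s. inverse (F1 (G s))) has_real_derivative G2 s) (at s)" if "s \<in> F ` I" for s
      unfolding G2_def
      by (rule DERIV_inverse'[OF DERIV_chain2[OF dF1[OF FG(2)[OF that]] dG[OF that]]])
        (metis F1pos less_irrefl)
    have cG: "continuous_on (F ` I) G"
      by (intro continuous_at_imp_continuous_on ballI) (rule DERIV_isCont[OF dG])
    have "continuous_on (F ` I) (\<lambda>s. F1 (G s))" "continuous_on (F ` I) (\<lambda>s. F2 (G s))"
      using continuous_on_compose2[OF cF1 cG] continuous_on_compose2[OF cF2 cG] FG(2) by auto
    then have cG2: "continuous_on (F ` I) G2"
      unfolding G2_def by (intro continuous_intros) (metis F1pos less_irrefl)+
    define y where "y = (\<lambda>x. G (v x))"
    have Fy: "F (y x) = v x" "y x \<in> I" if "x \<in> closure \<Omega>" for x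
      using FG[of "v x"] vI that by (auto simp: y_def)
    have C2v: "C_k_on 2 v \<Omega>" using v(2) by (simp add: harmonic_on_def)
    have C2y: "C_k_on 2 y \<Omega>"
      unfolding y_def by (rule C2_compose[OF \<Omega>(1) C2v vI' dG dG1 cG2])
    have yI: "y ` \<Omega> \<subseteq> I" using Fy(2) sub by blast
    have "harmonic_on \<Omega> (\<lambda>x. F (y x))"
      by (rule harmonic_on_cong[OF \<Omega>(1) v(2)]) (use Fy(1) sub in auto)
    then have "laplacian (\<lambda>x. F (y x)) x = 0" if "x \<in> \<Omega>" for x
      using that by (simp add: harmonic_on_def)
    moreover have "continuous_on (closure \<Omega>) y"
      unfolding y_def by (rule continuous_on_compose2[OF cG v(1) vI])
    moreover have "y x = g x" if "x \<in> frontier \<Omega>" for x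
      using that g(2) inj by (auto simp: y_def G_def v(3) inv_into_f_f)
    ultimately have "dirichlet_solution \<Omega> I H g y"
      unfolding dirichlet_solution_def using C2y Fy(2) pde[OF C2y yI] by auto
    then show ?thesis by blast
  qed
  moreover have "y x = z x"
    if y: "dirichlet_solution \<Omega> I H g y" and z: "dirichlet_solution \<Omega> I H g z" and x: "x \<in> closure \<Omega>"
    for y z x
  proof -
    have C: "continuous_on (closure \<Omega>) (\<lambda>x. F (w x)) \<and> harmonic_on \<Omega> (\<lambda>x. F (w x)) \<and>
        w x \<in> I \<and> (\<forall>x\<in>frontier \<Omega>. w x = g x)"
      if w: "dirichlet_solution \<Omega> I H g w" for w
    proof -
      have w': "continuous_on (closure \<Omega>) w" "C_k_on 2 w \<Omega>" "w ` closure \<Omega> \<subseteq> I" "w ` \<Omega> \<subseteq> I"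
        using w sub unfolding dirichlet_solution_def by blast+
      have "laplacian (\<lambda>x. F (w x)) x = 0" if "x \<in> \<Omega>" for x
        using pde[OF w'(2,4) that] w that unfolding dirichlet_solution_def by blast
      then show ?thesis
        using C2_compose[OF \<Omega>(1) w'(2,4) dF dF1 cF2] continuous_on_compose2[OF cF w'(1,3)] w x
        by (auto simp: harmonic_on_def dirichlet_solution_def)
    qed
    \<comment> \<open>Both transforms are harmonic with equal boundary values; injectivity of
      \<open>F\<close> on \<open>I\<close> then leads back to \<open>y\<close> and
      \<open>z\<close>.\<close>
    have "\<bar>F (y x) - F (z x)\<bar> \<le> 0"
    proof (rule harmonic_bound[OF \<Omega>(1,2) _ _ _ x])
      show "continuous_on (closure \<Omega>) (\<lambda>x. F (y x) - F (z x))"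
        using C[OF y] C[OF z] by (intro continuous_intros) auto
      show "harmonic_on \<Omega> (\<lambda>x. F (y x) - F (z x))"
        using C[OF y] C[OF z] by (simp add: harmonic_on_diff \<Omega>(1))
      show "\<bar>F (y x) - F (z x)\<bar> \<le> 0" if "x \<in> frontier \<Omega>" for x
        using C[OF y] C[OF z] that by simp
    qed
    then show ?thesis using inj C[OF y] C[OF z] by (simp add: inj_on_def)
  qed
  ultimately show "(\<exists>y. dirichlet_solution \<Omega> I H g y) \<and>
      (\<forall>y z. dirichlet_solution \<Omega> I H g y \<and> dirichlet_solution \<Omega> I H g z \<longrightarrow>
        (\<forall>x\<in>closure \<Omega>. y x = z x))" by blast
qed

end
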